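(* Let $B$ be a compact Riemann surface with a Riemannian metric $\rho$, let $\overline\Delta_1,\dots,\overline\Delta_t\subset B$ ($t\ge1$) be pairwise disjoint disks, let $B_0:=B\smallsetminus\bigsqcup_{i=1}^t\overline\Delta_i$, let $b_0\in B_0$, and fix a simple basis $\alpha_1,\dots,\alpha_k$ of $\pi_1(B_0,b_0)$. There exist constants $C,\delta'>0$, depending only on $\alpha_1,\dots,\alpha_k$, $B_0$ and $\rho$, such that for every finite set $S\subset B_0$ with $\#S=s\ge1$ there exist a point $q\in B_0\smallsetminus S$, a path $\sigma$ from $b_0$ to $q$ in $B_0$ with $\ell_\rho(\sigma)\le\delta'$, and loops $\hat\gamma_1,\dots,\hat\gamma_k\subset B_0\smallsetminus S$ based at $q$ such that $$[\sigma^{-1}\circ\hat\gamma_j\circ\sigma]=\alpha_j\quad\text{in }\pi_1(B_0,b_0)\qquad\text{for every }j=1,\dots,k,$$ and $$\ell_S(\hat\gamma_j)\le C\sqrt{(s+1)\log(s+2)}\qquad\text{for all }j=1,\dots,k.$$ Moreover, $\sigma$ and the loops $\hat\gamma_1,\dots,\hat\gamma_k$ are contained in a fixed compact set $\mathcal K_0\subset B_0$ and satisfy $\ell_\rho(\hat\gamma_j)\le L_0$ for all $j$, where $\mathcal K_0$ and $L_0>0$ depend only on $\alpha_1,\dots,\alpha_k$, $B_0$ and $\rho$ (not on $S$).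
   Context: A (closed topological) disk in $B$ is a closed subset of $B$ homeomorphic to the closed unit disk in $\mathbb C$, with piecewise-$C^1$ boundary. Compact Riemann surfaces are connected. If $g$ is the genus of $B$, then $\pi_1(B_0,b_0)$ is free of rank $k=2g+t-1$. A simple basis of $\pi_1(B_0,b_0)$ is a free basis $\alpha_1,\dots,\alpha_k$ consisting of (classes of) smooth simple loops at $b_0$. A smooth loop is a smooth map from $S^1$. Paths and loops are piecewise $C^1$; $\ell_\rho$ denotes $\rho$-length. Concatenation $\circ$ is written right to left: $\sigma^{-1}\circ\hat\gamma_j\circ\sigma$ is the loop at $b_0$ that traverses $\sigma$, then $\hat\gamma_j$, then $\sigma$ reversed. For a connected complex manifold $X$, with real tangent bundle $TX$ viewed as a complex vector bundle via the complex structure, the Kobayashi--Royden pseudo-metric is $$\kappa_X(x,v):=\inf\left\{\tfrac{2}{R}:R>0,\ \exists\,f\colon\Delta(0,R)\to X\text{ holomorphic with }f(0)=x,\ f'(0)=v\right\},$$ where $\Delta(0,R)\subset\mathbb C$ is the open disk of radius $R$ centered at $0$. For a finite set $S\subset B_0$, $\kappa_S$ denotes the Kobayashi--Royden metric of the hyperbolic surface $B_0\smallsetminus S$, and for a path $\gamma\colon[0,1]\to B_0\smallsetminus S$, $\ell_S(\gamma):=\int_0^1\kappa_S(\gamma(t),\gamma'(t))\,dt$. *)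

theory Defs
  imports "HOL-Complex_Analysis.Complex_Analysis" "HOL-Algebra.Group"
begin

section \<open>Smooth maps between normed spaces\<close>

text \<open>Meant for open sets of finite-dimensional spaces, where continuity of all iterated
  directional derivatives amounts to being \<open>k\<close> times continuously differentiable.\<close>

primrec Ck_on :: "nat \<Rightarrow> 'a set \<Rightarrow> ('a::real_normed_vector \<Rightarrow> 'b::real_normed_vector) \<Rightarrow> bool" where
  "Ck_on 0 U f \<longleftrightarrow> continuous_on U f"
| "Ck_on (Suc k) U f \<longleftrightarrow>
     (\<exists>f'. (\<forall>x\<in>U. (f has_derivative f' x) (at x)) \<and> (\<forall>v. Ck_on k U (\<lambda>x. f' x v)))"

definition smooth_on :: "'a set \<Rightarrow> ('a::real_normed_vector \<Rightarrow> 'b::real_normed_vector) \<Rightarrow> bool" where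
  "smooth_on U f \<longleftrightarrow> (\<forall>k. Ck_on k U f)"

text \<open>\<open>C\<^sup>1\<close> on a set of reals, with one-sided derivatives at the end points; the library's
  \<open>C1_differentiable_on\<close> uses two-sided derivatives.\<close>

definition C1_within :: "real set \<Rightarrow> (real \<Rightarrow> 'b::real_normed_vector) \<Rightarrow> bool" where
  "C1_within I f \<longleftrightarrow>
     (\<exists>D. (\<forall>t\<in>I. (f has_vector_derivative D t) (at t within I)) \<and> continuous_on I D)"


section \<open>Riemann surfaces\<close>

text \<open>The surface is the whole type \<open>'a\<close>. A chart is a pair of its domain and a function that is
  only meaningful on that domain. The atlas need not be maximal.\<close>

type_synonym 'a chart = "'a set \<times> ('a \<Rightarrow> complex)"
type_synonym 'a atlas = "'a chart set"

definition transition :: "'a chart \<Rightarrow> 'a chart \<Rightarrow> complex \<Rightarrow> complex" where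
  "transition c d = snd d \<circ> inv_into (fst c) (snd c)"

definition compact_riemann_surface :: "('a::t2_space) atlas \<Rightarrow> bool" where
  "compact_riemann_surface A \<longleftrightarrow>
     compact (UNIV :: 'a set) \<and> connected (UNIV :: 'a set) \<and>
     (\<Union>c\<in>A. fst c) = UNIV \<and>
     (\<forall>(U, \<phi>)\<in>A. open U \<and> open (\<phi> ` U) \<and> homeomorphism U (\<phi> ` U) \<phi> (inv_into U \<phi>)) \<and>
     (\<forall>c\<in>A. \<forall>d\<in>A. transition c d holomorphic_on snd c ` (fst c \<inter> fst d))"

definition holomorphic_into :: "('a::t2_space) atlas \<Rightarrow> complex set \<Rightarrow> 'a set \<Rightarrow> (complex \<Rightarrow> 'a) \<Rightarrow> bool" where
  "holomorphic_into A D X f \<longleftrightarrow>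
     f ` D \<subseteq> X \<and> continuous_on D f \<and>
     (\<forall>(U, \<phi>)\<in>A. (\<phi> \<circ> f) holomorphic_on {z\<in>D. f z \<in> U})"


section \<open>Tangent vectors and Riemannian metrics\<close>

text \<open>A tangent vector at \<open>x\<close> is the family of its coordinates in all charts around \<open>x\<close>, related
  to each other by the derivatives of the transition maps; charts not around \<open>x\<close> get \<open>0\<close>.\<close>

type_synonym 'a tvec = "'a chart \<Rightarrow> complex"

definition tangent_space :: "'a atlas \<Rightarrow> 'a \<Rightarrow> 'a tvec set" where
  "tangent_space A x =
     {v. (\<forall>c. \<not> (c \<in> A \<and> x \<in> fst c) \<longrightarrow> v c = 0) \<and>
         (\<forall>c\<in>A. \<forall>d\<in>A. x \<in> fst c \<and> x \<in> fst d \<longrightarrow> v d = deriv (transition c d) (snd c x) * v c)}"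

definition tvec_of_coord :: "'a atlas \<Rightarrow> 'a \<Rightarrow> 'a chart \<Rightarrow> complex \<Rightarrow> 'a tvec" where
  "tvec_of_coord A x c a =
     (\<lambda>d. if d \<in> A \<and> x \<in> fst d then deriv (transition c d) (snd c x) * a else 0)"

definition riemannian_metric ::
    "('a::t2_space) atlas \<Rightarrow> ('a \<Rightarrow> 'a tvec \<Rightarrow> 'a tvec \<Rightarrow> real) \<Rightarrow> bool" where
  "riemannian_metric A \<rho> \<longleftrightarrow>
     (\<forall>x. \<forall>u\<in>tangent_space A x. \<forall>v\<in>tangent_space A x. \<forall>w\<in>tangent_space A x. \<forall>r.
        \<rho> x u v = \<rho> x v u \<and>
        \<rho> x (\<lambda>c. u c + v c) w = \<rho> x u w + \<rho> x v w \<and>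
        \<rho> x (\<lambda>c. complex_of_real r * u c) w = r * \<rho> x u w) \<and>
     (\<forall>x. \<forall>u\<in>tangent_space A x. u \<noteq> (\<lambda>c. 0) \<longrightarrow> \<rho> x u u > 0) \<and>
     (\<forall>(U, \<phi>)\<in>A. \<forall>a b. smooth_on (\<phi> ` U)
        (\<lambda>z. let x = inv_into U \<phi> z
             in \<rho> x (tvec_of_coord A x (U, \<phi>) a) (tvec_of_coord A x (U, \<phi>) b)))"


section \<open>Paths, smooth loops and disks\<close>

definition C1_curve_on :: "('a::t2_space) atlas \<Rightarrow> real set \<Rightarrow> (real \<Rightarrow> 'a) \<Rightarrow> bool" where
  "C1_curve_on A I \<gamma> \<longleftrightarrow>
     continuous_on I \<gamma> \<and> (\<forall>(U, \<phi>)\<in>A. C1_within {t\<in>I. \<gamma> t \<in> U} (\<phi> \<circ> \<gamma>))"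

definition pw_C1_path :: "('a::t2_space) atlas \<Rightarrow> (real \<Rightarrow> 'a) \<Rightarrow> bool" where
  "pw_C1_path A \<gamma> \<longleftrightarrow>
     (\<exists>(n::nat) a. a 0 = 0 \<and> a n = 1 \<and>
        (\<forall>i<n. a i < a (Suc i) \<and> C1_curve_on A {a i..a (Suc i)} \<gamma>))"

text \<open>The smooth structure of the circle is the one for which \<open>t \<mapsto> cis (2 * pi * t)\<close> is a local
  diffeomorphism, so smoothness of \<open>F\<close> on the circle is smoothness of its periodic lift.\<close>

definition smooth_loop :: "('a::t2_space) atlas \<Rightarrow> (real \<Rightarrow> 'a) \<Rightarrow> bool" where
  "smooth_loop A \<gamma> \<longleftrightarrow>
     (\<exists>F :: complex \<Rightarrow> 'a.
        (\<forall>t\<in>{0..1}. \<gamma> t = F (cis (2 * pi * t))) \<and>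
        continuous_on UNIV (\<lambda>t. F (cis (2 * pi * t))) \<and>
        (\<forall>(U, \<phi>)\<in>A. smooth_on {t. F (cis (2 * pi * t)) \<in> U} (\<lambda>t. \<phi> (F (cis (2 * pi * t))))))"

definition closed_disk :: "('a::t2_space) atlas \<Rightarrow> 'a set \<Rightarrow> bool" where
  "closed_disk A D \<longleftrightarrow>
     closed D \<and>
     (\<exists>h h'. homeomorphism (cball (0::complex) 1) D h h' \<and>
        (\<exists>\<gamma>. pw_C1_path A \<gamma> \<and> simple_path \<gamma> \<and> pathfinish \<gamma> = pathstart \<gamma> \<and>
             path_image \<gamma> = h ` sphere 0 1))"


section \<open>Lengths\<close>

definition velocity :: "'a atlas \<Rightarrow> (real \<Rightarrow> 'a) \<Rightarrow> real \<Rightarrow> 'a tvec" where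
  "velocity A \<gamma> t =
     (\<lambda>c. if c \<in> A \<and> \<gamma> t \<in> fst c
          then vector_derivative (snd c \<circ> \<gamma>) (at t within {0..1}) else 0)"

definition holomorphic_velocity :: "'a atlas \<Rightarrow> (complex \<Rightarrow> 'a) \<Rightarrow> complex \<Rightarrow> 'a tvec" where
  "holomorphic_velocity A f z =
     (\<lambda>c. if c \<in> A \<and> f z \<in> fst c then deriv (snd c \<circ> f) z else 0)"

text \<open>Values in \<open>ennreal\<close> keep an infimum over the empty set and a divergent integral infinite.\<close>

definition kobayashi_royden :: "('a::t2_space) atlas \<Rightarrow> 'a set \<Rightarrow> 'a \<Rightarrow> 'a tvec \<Rightarrow> ennreal" where
  "kobayashi_royden A X x v =
     (INF R\<in>{R::real. R > 0 \<and>
        (\<exists>f. holomorphic_into A (ball 0 R) X f \<and> f 0 = x \<and> holomorphic_velocity A f 0 = v)}.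
      ennreal (2 / R))"

definition kobayashi_length :: "('a::t2_space) atlas \<Rightarrow> 'a set \<Rightarrow> (real \<Rightarrow> 'a) \<Rightarrow> ennreal" where
  "kobayashi_length A X \<gamma> =
     (\<integral>\<^sup>+t\<in>{0..1}. kobayashi_royden A X (\<gamma> t) (velocity A \<gamma> t) \<partial>lborel)"

definition riemannian_length ::
    "'a atlas \<Rightarrow> ('a \<Rightarrow> 'a tvec \<Rightarrow> 'a tvec \<Rightarrow> real) \<Rightarrow> (real \<Rightarrow> 'a) \<Rightarrow> ennreal" where
  "riemannian_length A \<rho> \<gamma> =
     (\<integral>\<^sup>+t\<in>{0..1}. ennreal (sqrt (\<rho> (\<gamma> t) (velocity A \<gamma> t) (velocity A \<gamma> t))) \<partial>lborel)"


section \<open>The fundamental group and its free bases\<close>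

definition loops_at :: "('a::topological_space) set \<Rightarrow> 'a \<Rightarrow> (real \<Rightarrow> 'a) set" where
  "loops_at X b = {p. path p \<and> path_image p \<subseteq> X \<and> pathstart p = b \<and> pathfinish p = b}"

definition loop_class :: "('a::topological_space) set \<Rightarrow> (real \<Rightarrow> 'a) \<Rightarrow> (real \<Rightarrow> 'a) set" where
  "loop_class X p = {q. homotopic_paths X p q}"

text \<open>Concatenation is written right to left: the product of the classes of \<open>p\<close> and \<open>q\<close>
  traverses \<open>q\<close> first.\<close>

definition fundamental_group :: "('a::topological_space) set \<Rightarrow> 'a \<Rightarrow> (real \<Rightarrow> 'a) set monoid" where
  "fundamental_group X b =
     \<lparr>carrier = loop_class X ` loops_at X b,
      mult = (\<lambda>P Q. {r. \<exists>p\<in>P. \<exists>q\<in>Q. homotopic_paths X (q +++ p) r}),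
      one = loop_class X (\<lambda>_. b)\<rparr>"

text \<open>Words in the letters \<open>\<alpha>\<^sub>1\<^sup>\<plusminus>, \<dots>, \<alpha>\<^sub>k\<^sup>\<plusminus>\<close>: the pair \<open>(i, e)\<close> stands for \<open>\<alpha>\<^sub>i\<close> if \<open>e\<close> holds and for its
  inverse otherwise.\<close>

definition reduced_words :: "nat \<Rightarrow> (nat \<times> bool) list set" where
  "reduced_words k =
     {w. fst ` set w \<subseteq> {1..k} \<and> successively (\<lambda>(i, e) (j, f). \<not> (i = j \<and> e \<noteq> f)) w}"

definition word_value :: "('g, 'm) monoid_scheme \<Rightarrow> (nat \<Rightarrow> 'g) \<Rightarrow> (nat \<times> bool) list \<Rightarrow> 'g" where
  "word_value G \<alpha> w =
     foldr (\<lambda>(i, e) g. (if e then \<alpha> i else inv\<^bsub>G\<^esub> (\<alpha> i)) \<otimes>\<^bsub>G\<^esub> g) w \<one>\<^bsub>G\<^esub>"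

definition free_basis :: "('g, 'm) monoid_scheme \<Rightarrow> nat \<Rightarrow> (nat \<Rightarrow> 'g) \<Rightarrow> bool" where
  "free_basis G k \<alpha> \<longleftrightarrow>
     \<alpha> ` {1..k} \<subseteq> carrier G \<and>
     (\<forall>g\<in>carrier G. \<exists>!w. w \<in> reduced_words k \<and> word_value G \<alpha> w = g)"

definition simple_basis ::
    "('a::t2_space) atlas \<Rightarrow> 'a set \<Rightarrow> 'a \<Rightarrow> nat \<Rightarrow> (nat \<Rightarrow> (real \<Rightarrow> 'a) set) \<Rightarrow> bool" where
  "simple_basis A X b k \<alpha> \<longleftrightarrow>
     free_basis (fundamental_group X b) k \<alpha> \<and>
     (\<forall>j\<in>{1..k}. \<exists>p\<in>loops_at X b. smooth_loop A p \<and> simple_path p \<and> \<alpha> j = loop_class X p)"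

end

theory Submission
  imports Defs
begin

text \<open>The Kobayashi--Royden metric is needed only through an upper bound: if the coordinate disk of radius
\<open>\<delta>\<close> about \<open>x\<close> lies in \<open>B\<^sub>0 - S\<close>, then an affine test disk shows \<open>\<kappa>\<^sub>S(x, v) \<le> 2 \<bar>v\<bar> / \<delta>\<close>
(\<open>kobayashi_royden_le\<close>). On a compact part of \<open>B\<^sub>0\<close> the metric is thus at most a constant times
\<open>1 + 1 / dist(x, S)\<close>, and although a given loop may run into \<open>S\<close>, the singularity \<open>1 / dist\<close> is
integrable over the plane: \<open>s\<close> points contribute most when each of them governs a disk of area about
\<open>1 / s\<close>, and then the integral of \<open>1 / dist(x, S)\<close> over a bounded region is \<open>O(\<surd>s)\<close>
(\<open>nn_integral_inv_dist_majorant_le\<close>).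

So each loop \<open>\<alpha>\<^sub>j\<close> is moved in a family \<open>\<Gamma>\<^sub>j(w, t)\<close>, with a complex parameter \<open>w\<close> in a small disk
and \<open>\<Gamma>\<^sub>j(0, t) = \<alpha>\<^sub>j(t)\<close>, such that for fixed \<open>t\<close> the map \<open>w \<mapsto> \<Gamma>\<^sub>j(w, t)\<close> is Lipschitz from
below in a chart, uniformly in \<open>t\<close>. By Tonelli the average over \<open>w\<close> of the length of \<open>\<Gamma>\<^sub>j(w, \<cdot>)\<close> is
\<open>O(\<surd>s)\<close>, hence some single \<open>w\<close> serves all \<open>j\<close>. A loop that hits \<open>S\<close> has an infinite majorant, since
\<open>1 / t\<close> is not integrable at \<open>0\<close>; so the chosen loops avoid \<open>S\<close>. The bound \<open>O(\<surd>s)\<close> implies the stated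
one because \<open>ln (s + 2) \<ge> 1\<close>. All data besides \<open>w\<close> come from compactness and do not involve \<open>S\<close>, whence
the uniform compact set and the uniform Riemannian lengths.

The base point \<open>b\<^sub>0\<close> moves to \<open>q = nudge b\<^sub>0 w\<close>, the point with coordinate \<open>w\<close> in a chart chosen at
\<open>b\<^sub>0\<close>, the same for every \<open>j\<close>. The path \<open>\<sigma>\<close> is \<open>u \<mapsto> nudge b\<^sub>0 (u w)\<close>, and the square
\<open>(u, t) \<mapsto> \<Gamma>\<^sub>j(u w, t)\<close> is a homotopy from \<open>\<alpha>\<^sub>j\<close> to \<open>\<sigma>\<close>, then \<open>\<Gamma>\<^sub>j(w, \<cdot>)\<close>, then \<open>\<sigma>\<close> reversed
(\<open>homotopic_paths_conjugate_square\<close>).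

To build \<open>\<Gamma>\<^sub>j\<close>, the interval is bisected until each piece of \<open>\<alpha>\<^sub>j\<close> lies in one chart. At a division
point \<open>x\<close> the family is \<open>nudge x w\<close>, which depends on \<open>x\<close> only, so that adjacent pieces fit together.
Inside a chart the two end motions \<open>Q\<^sub>0, Q\<^sub>1\<close> are holomorphic in \<open>w\<close> with nonzero derivatives at \<open>0\<close>, and
they are joined through maps whose derivatives at \<open>0\<close> follow a path in the nonzero complex numbers
(\<open>lower_lipschitz_edge_family\<close>).\<close>

section \<open>Integrals over intervals and averages\<close>

text \<open>The length integrands below are not known to be measurable, so their integrals are lower integrals.
These are still subadditive in the domain, because a simple function below \<open>f\<close> on \<open>A \<union> B\<close> can be cut
along \<open>A\<close> and \<open>B\<close>.\<close>

lemma nn_integral_Un_le: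
  fixes f :: "'a \<Rightarrow> ennreal"
  assumes A: "A \<in> sets M" and B: "B \<in> sets M"
  shows "(\<integral>\<^sup>+x\<in>A \<union> B. f x \<partial>M) \<le> (\<integral>\<^sup>+x\<in>A. f x \<partial>M) + (\<integral>\<^sup>+x\<in>B. f x \<partial>M)"
  unfolding nn_integral_def[of M "\<lambda>x. f x * indicator (A \<union> B) x"]
proof (rule SUP_least, clarsimp)
  fix g assume g: "simple_function M g" and le: "g \<le> (\<lambda>x. f x * indicator (A \<union> B) x)"
  have [measurable]: "g \<in> borel_measurable M" using g by (rule borel_measurable_simple_function)
  note [measurable] = A B
  have "g x \<le> g x * indicator A x + g x * indicator B x" for x
    using le[THEN le_funD, of x] by (auto simp: indicator_def split: if_splits)
  then have "(\<integral>\<^sup>+x. g x \<partial>M) \<le> (\<integral>\<^sup>+x. g x * indicator A x + g x * indicator B x \<partial>M)"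
    by (intro nn_integral_mono) auto
  also have "\<dots> = (\<integral>\<^sup>+x. g x * indicator A x \<partial>M) + (\<integral>\<^sup>+x. g x * indicator B x \<partial>M)"
    by (rule nn_integral_add) measurable
  also have "\<dots> \<le> (\<integral>\<^sup>+x\<in>A. f x \<partial>M) + (\<integral>\<^sup>+x\<in>B. f x \<partial>M)"
  proof (intro add_mono nn_integral_mono)
    fix x
    show "g x * indicator A x \<le> f x * indicator A x" "g x * indicator B x \<le> f x * indicator B x"
      using le[THEN le_funD, of x] by (auto simp: indicator_def split: if_splits)
  qed
  finally show "integral\<^sup>S M g \<le> (\<integral>\<^sup>+x\<in>A. f x \<partial>M) + (\<integral>\<^sup>+x\<in>B. f x \<partial>M)"
    using nn_integral_eq_simple_integral[OF g] by simp
qed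

text \<open>At an end point of a piece the velocity depends on how the curve continues; these two points are null.\<close>

lemma set_nn_integral_mono_open_interval:
  fixes f :: "real \<Rightarrow> ennreal"
  assumes "\<And>t. t \<in> {a<..<b} \<Longrightarrow> f t \<le> g t"
  shows "(\<integral>\<^sup>+t\<in>{a..b}. f t \<partial>lborel) \<le> (\<integral>\<^sup>+t\<in>{a..b}. g t \<partial>lborel)"
proof (rule nn_integral_mono_AE)
  have "AE t in lborel. t \<noteq> a" "AE t in lborel. t \<noteq> b" by (rule AE_lborel_singleton)+
  then show "AE t in lborel. f t * indicator {a..b} t \<le> g t * indicator {a..b} t"
    by eventually_elim (use assms in \<open>auto simp: indicator_def\<close>)
qed

text \<open>The finite exceptional set \<open>E\<close> is null, so if \<open>M\<close> exceeded \<open>D\<close> off \<open>E\<close>, its integral would be at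
least \<open>D\<close> times the measure of \<open>W\<close>.\<close>

lemma exists_below_average:
  fixes M :: "complex \<Rightarrow> ennreal"
  assumes W: "W \<in> sets borel" "emeasure lborel W = ennreal v" and E: "finite E"
    and I: "(\<integral>\<^sup>+w\<in>W. M w \<partial>lborel) \<le> ennreal I" and D: "0 \<le> D" "0 \<le> v" "0 \<le> I" "I < D * v"
  shows "\<exists>w\<in>W - E. M w \<le> ennreal D"
proof (rule ccontr)
  assume "\<not> ?thesis"
  then have big: "ennreal D \<le> M w" if "w \<in> W - E" for w using that by force
  have "AE w in lborel. w \<notin> E" by (intro AE_not_in finite_imp_null_set_lborel E)
  then have "(\<integral>\<^sup>+w\<in>W. ennreal D \<partial>lborel) \<le> (\<integral>\<^sup>+w\<in>W. M w \<partial>lborel)"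
    by (intro nn_integral_mono_AE, eventually_elim) (use big in \<open>auto simp: indicator_def\<close>)
  then have "ennreal (D * v) \<le> ennreal I"
    using I W D by (simp add: nn_integral_cmult_indicator ennreal_mult)
  then show False using D by simp
qed

section \<open>A dyadic majorant of the inverse distance to a finite set\<close>

text \<open>Up to constants, the larger of \<open>N\<close> and the sum over the points \<open>p\<close> of \<open>T\<close> of \<open>1 / dist x p\<close>, cut off
at distance \<open>1 / N\<close>. Cutting each singularity into dyadic layers makes its integral a geometric series.
The value is infinite on \<open>T\<close>. For \<open>s\<close> points the balanced choice is \<open>N = sqrt s\<close>.\<close>

definition inv_dist_majorant :: "real \<Rightarrow> complex set \<Rightarrow> complex \<Rightarrow> ennreal" where
  "inv_dist_majorant N T x =
     ennreal N + (\<Sum>p\<in>T. \<Sum>k. ennreal (2^(k+1) * N) * indicator (ball p (1 / (2^k * N))) x)"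

lemma inv_dist_majorant_measurable [measurable]:
  "inv_dist_majorant N T \<in> borel_measurable borel"
proof -
  have [measurable]: "ball p r \<in> sets borel" for p :: complex and r by simp
  show ?thesis unfolding inv_dist_majorant_def by measurable
qed

text \<open>The radius is \<open>1 / N\<close> if \<open>T\<close> is that far away, and otherwise the distance to the nearest point of \<open>T\<close>,
which falls into one of the dyadic shells.\<close>

lemma inv_dist_majorant_ge:
  assumes T: "finite T" and N: "N > 0" and x: "x \<notin> T"
  shows "\<exists>\<delta>>0. (\<forall>p\<in>T. \<delta> \<le> dist x p) \<and> ennreal (1 / \<delta>) \<le> inv_dist_majorant N T x"
proof (cases "\<forall>p\<in>T. 1 / N \<le> dist x p")
  case True
  then show ?thesis using N by (intro exI[of _ "1/N"]) (auto simp: inv_dist_majorant_def)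
next
  case False
  then have ne: "dist x ` T \<noteq> {}" by auto
  define \<delta> where "\<delta> = Min (dist x ` T)"
  have le: "\<delta> \<le> dist x p" if "p \<in> T" for p using that T by (auto simp: \<delta>_def)
  from False have small: "\<delta> < 1 / N" using le by fastforce
  obtain p where p: "p \<in> T" "\<delta> = dist x p"
    using Min_in[OF _ ne] T unfolding \<delta>_def by auto
  have \<delta>: "\<delta> > 0" using p x by auto
  have "\<exists>k::nat. 1 / (\<delta> * N) < 2 ^ k" by (rule real_arch_pow) simp
  then obtain k0 :: nat where "1 / (2^k0 * N) \<le> \<delta>" 
    using \<delta> N by (auto simp: field_simps intro: less_imp_le)
  then have ex: "\<exists>k::nat. 1 / (2^k * N) \<le> \<delta>" ..
  \<comment> \<open>The distance lies in the shell between the radii of index \<open>j - 1\<close> and \<open>j\<close>.\<close>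
  define j where "j = (LEAST k::nat. 1 / (2^k * N) \<le> \<delta>)"
  have j: "1 / (2^j * N) \<le> \<delta>" unfolding j_def using ex by (rule LeastI_ex)
  have "j \<noteq> 0" using j small by (intro notI) simp
  then obtain k where k: "j = Suc k" by (cases j) auto
  have dk: "\<delta> < 1 / (2^k * N)"
    using not_less_Least[of k "\<lambda>k. 1 / (2^k * N) \<le> \<delta>"] k unfolding j_def by auto
  let ?f = "\<lambda>p k. ennreal (2^(k+1) * N) * indicator (ball p (1 / (2^k * N))) x"
  have "ennreal (1/\<delta>) \<le> ennreal (2^(k+1) * N)"
    using j \<delta> N by (intro ennreal_leI) (auto simp: k field_simps)
  also have "\<dots> = ?f p k" using dk p by (auto simp: dist_commute)
  also have "\<dots> \<le> (\<Sum>k. ?f p k)" 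
    using sum_le_suminf[of "?f p" "{k}", OF summableI] by (metis (no_types, lifting) finite.intros sum.insert sum.empty empty_iff add.right_neutral zero_le)
  also have "\<dots> \<le> (\<Sum>p\<in>T. \<Sum>k. ?f p k)" using p T
    by (intro member_le_sum) auto
  also have "\<dots> \<le> inv_dist_majorant N T x" by (auto simp: inv_dist_majorant_def)
  finally show ?thesis using \<delta> le by blast
qed

text \<open>The preimage has diameter at most \<open>2 * d / m\<close>, so it lies in a disk of that radius about any of its
points; this replaces a change of variables.\<close>

lemma emeasure_preimage_ball_le:
  fixes X :: "complex \<Rightarrow> complex"
  assumes m: "m > 0" and d: "d > 0"
    and X: "\<And>w w'. w \<in> W \<Longrightarrow> w' \<in> W \<Longrightarrow> m * dist w w' \<le> dist (X w) (X w')"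
  shows "emeasure lborel {w\<in>W. X w \<in> ball p d} \<le> ennreal (pi * (2 * d / m)\<^sup>2)"
proof (cases "{w\<in>W. X w \<in> ball p d} = {}")
  case True
  then show ?thesis by (metis emeasure_empty zero_le)
next
  case False
  then obtain w0 where w0: "w0 \<in> W" "X w0 \<in> ball p d" by auto
  have "{w\<in>W. X w \<in> ball p d} \<subseteq> cball w0 (2 * d / m)"
  proof clarify
    fix w assume w: "w \<in> W" "X w \<in> ball p d"
    have "m * dist w0 w \<le> dist (X w0) (X w)" using X w w0 by auto
    also have "\<dots> \<le> 2 * d" using w(2) w0(2) dist_triangle2[of "X w0" "X w" p]
      by (auto simp: dist_commute)
    finally show "w \<in> cball w0 (2 * d / m)" using m by (auto simp: field_simps)
  qed
  then have "emeasure lborel {w\<in>W. X w \<in> ball p d} \<le> emeasure lborel (cball w0 (2 * d / m))"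
    by (intro emeasure_mono) auto
  also have "\<dots> = ennreal (pi * (2 * d / m)\<^sup>2)"
    using m d by (subst emeasure_cball) (auto simp: unit_ball_vol_2)
  finally show ?thesis .
qed

text \<open>The layer of index \<open>k\<close> about one point has height of order \<open>2\<^sup>k N\<close> and area of order \<open>4\<^sup>-\<^sup>k / N\<^sup>2\<close>, so a
point contributes \<open>O(1 / N)\<close>, and the at most \<open>N\<^sup>2\<close> points together contribute \<open>O(N)\<close>.\<close>

lemma nn_integral_inv_dist_majorant_le:
  fixes X :: "complex \<Rightarrow> complex"
  assumes m: "m > 0" and N: "N > 0" and T: "finite T" "real (card T) \<le> N\<^sup>2"
    and [measurable]: "W \<in> sets borel" "X \<in> borel_measurable borel"
    and X: "\<And>w w'. w \<in> W \<Longrightarrow> w' \<in> W \<Longrightarrow> m * dist w w' \<le> dist (X w) (X w')"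
  shows "(\<integral>\<^sup>+w\<in>W. inv_dist_majorant N T (X w) \<partial>lborel)
           \<le> ennreal N * emeasure lborel W + ennreal (16 * pi / m\<^sup>2 * N)"
proof -
  have [measurable]: "ball p r \<in> sets borel" for p :: complex and r by simp
  let ?b = "\<lambda>p k w. indicator {w\<in>W. X w \<in> ball p (1 / (2^k * N))} w"
  have eq: "inv_dist_majorant N T (X w) * indicator W w
      = ennreal N * indicator W w + (\<Sum>p\<in>T. \<Sum>k. ennreal (2^(k+1) * N) * ?b p k w)" for w
    by (auto simp: inv_dist_majorant_def indicator_def intro!: arg_cong2[where f="(+)"] sum.cong suminf_cong)
  have dyadic: "(\<integral>\<^sup>+w. ennreal (2^(k+1) * N) * ?b p k w \<partial>lborel)
                \<le> ennreal (8 * pi / (N * m\<^sup>2) * (1/2)^k)" for p k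
  proof -
    have "(\<integral>\<^sup>+w. ennreal (2^(k+1) * N) * ?b p k w \<partial>lborel)
       = ennreal (2^(k+1) * N) * emeasure lborel {w\<in>W. X w \<in> ball p (1 / (2^k * N))}"
      by (subst nn_integral_cmult_indicator) auto
    also have "\<dots> \<le> ennreal (2^(k+1) * N) * ennreal (pi * (2 * (1 / (2^k * N)) / m)\<^sup>2)"
      using N m X by (intro mult_left_mono emeasure_preimage_ball_le) auto
    also have "\<dots> = ennreal (8 * pi / (N * m\<^sup>2) * (1/2)^k)"
      using N m by (simp add: ennreal_mult[symmetric] field_simps power2_eq_square)
    finally show ?thesis .
  qed
  have "(\<integral>\<^sup>+w. (\<Sum>k. ennreal (2^(k+1) * N) * ?b p k w) \<partial>lborel) \<le> ennreal (16 * pi / (N * m\<^sup>2))" for p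
  proof -
    have "(\<integral>\<^sup>+w. (\<Sum>k. ennreal (2^(k+1) * N) * ?b p k w) \<partial>lborel)
      = (\<Sum>k. (\<integral>\<^sup>+w. ennreal (2^(k+1) * N) * ?b p k w \<partial>lborel))"
      by (rule nn_integral_suminf) measurable
    also have "\<dots> \<le> (\<Sum>k. ennreal (8 * pi / (N * m\<^sup>2) * (1/2)^k))"
      by (intro suminf_le dyadic) auto
    also have "\<dots> = ennreal (\<Sum>k. 8 * pi / (N * m\<^sup>2) * (1/2)^k)"
      using N m by (intro suminf_ennreal2 summable_mult summable_geometric) auto
    also have "(\<Sum>k. 8 * pi / (N * m\<^sup>2) * (1/2::real)^k) = 16 * pi / (N * m\<^sup>2)"
      by (subst suminf_mult) (auto simp: suminf_geometric summable_geometric)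
    finally show ?thesis .
  qed
  then have "(\<Sum>p\<in>T. \<integral>\<^sup>+w. (\<Sum>k. ennreal (2^(k+1) * N) * ?b p k w) \<partial>lborel)
      \<le> (\<Sum>p\<in>T. ennreal (16 * pi / (N * m\<^sup>2)))" by (intro sum_mono)
  also have "\<dots> = ennreal (card T * (16 * pi / (N * m\<^sup>2)))"
    using N by (subst ennreal_mult) (auto simp: ennreal_of_nat_eq_real_of_nat)
  also have "\<dots> \<le> ennreal (N\<^sup>2 * (16 * pi / (N * m\<^sup>2)))"
    using N T by (intro ennreal_leI mult_right_mono) auto
  also have "N\<^sup>2 * (16 * pi / (N * m\<^sup>2)) = 16 * pi / m\<^sup>2 * N"
    using N by (simp add: power2_eq_square)
  finally have S: "(\<Sum>p\<in>T. \<integral>\<^sup>+w. (\<Sum>k. ennreal (2^(k+1) * N) * ?b p k w) \<partial>lborel)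
      \<le> ennreal (16 * pi / m\<^sup>2 * N)" .
  have "(\<integral>\<^sup>+w\<in>W. inv_dist_majorant N T (X w) \<partial>lborel)
      = ennreal N * emeasure lborel W
        + (\<Sum>p\<in>T. \<integral>\<^sup>+w. (\<Sum>k. ennreal (2^(k+1) * N) * ?b p k w) \<partial>lborel)"
    unfolding eq by (subst nn_integral_add) (auto simp: nn_integral_cmult_indicator nn_integral_sum)
  then show ?thesis using S by (simp add: add_left_mono)
qed

text \<open>A Lipschitz curve through a point of \<open>T\<close> stays in the \<open>k\<close>-th disk about it for a time of order
\<open>2\<^sup>-\<^sup>k\<close>, so every dyadic layer contributes at least a fixed \<open>c > 0\<close>.\<close>

lemma nn_integral_inv_dist_majorant_eq_top:
  fixes \<gamma> :: "real \<Rightarrow> complex"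
  assumes ab: "a < b" and t0: "t0 \<in> {a..b}" and hit: "\<gamma> t0 \<in> T" and T: "finite T" and N: "N > 0"
    and V: "V > 0" and lip: "\<And>t. t \<in> {a..b} \<Longrightarrow> dist (\<gamma> t0) (\<gamma> t) \<le> V * \<bar>t - t0\<bar>"
  shows "(\<integral>\<^sup>+t\<in>{a..b}. inv_dist_majorant N T (\<gamma> t) \<partial>lborel) = \<infinity>"
proof -
  define c where "c = min (N * (b - a)) (2 / V)"
  have c: "c > 0" using ab N V by (auto simp: c_def)
  define h where "h k = min ((b - a)/2) (1 / (2^k * N * V))" for k :: nat
  \<comment> \<open>The hit may happen at an end of the interval, so only the longer side of \<open>t0\<close> is used.\<close>
  define I where "I k = (if b - t0 \<ge> (b-a)/2 then {t0<..<t0 + h k} else {t0 - h k<..<t0})" for k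
  have h: "h k > 0" for k using ab N V by (auto simp: h_def)
  have Isub: "I k \<subseteq> {a..b}" for k using t0 ab by (auto simp: I_def h_def min_def field_simps split: if_splits)
  have [measurable]: "I k \<in> sets borel" for k by (auto simp: I_def)
  have emI: "emeasure lborel (I k) = ennreal (h k)" for k using h[of k] by (auto simp: I_def)
  have near: "\<gamma> t \<in> ball (\<gamma> t0) (1 / (2^k * N))" if "t \<in> I k" for t k
  proof -
    have "dist (\<gamma> t0) (\<gamma> t) \<le> V * \<bar>t - t0\<bar>" using that Isub by (intro lip) blast
    also have "\<dots> < V * h k" using that V h[of k] by (auto simp: I_def split: if_splits)
    also have "\<dots> \<le> V * (1 / (2^k * N * V))" using V by (intro mult_left_mono) (auto simp: h_def)
    finally show ?thesis using V by simp
  qed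
  have hc: "c \<le> 2^(k+1) * N * h k" for k
  proof -
    have "N * (b-a) \<le> 2^k * (N * (b - a))" using mult_right_mono[of 1 "2^k" "N * (b - a)"] N ab by auto
    moreover have "h k = (b - a)/2 \<or> h k = 1 / (2^k * N * V)" by (auto simp: h_def min_def)
    ultimately show ?thesis using N V by (auto simp: c_def algebra_simps intro: min.coboundedI1 min.coboundedI2)
  qed
  let ?f = "\<lambda>p k x. ennreal (2^(k+1) * N) * indicator (ball p (1 / (2^k * N))) x :: ennreal"
  have "(\<Sum>k. ennreal (2^(k+1) * N) * indicator (I k) t)
      \<le> inv_dist_majorant N T (\<gamma> t) * indicator {a..b} t" for t
  proof (cases "t \<in> {a..b}")
    case True
    have "(\<Sum>k. ennreal (2^(k+1) * N) * indicator (I k) t) \<le> (\<Sum>k. ?f (\<gamma> t0) k (\<gamma> t))"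
      using near by (intro suminf_le) (auto simp: indicator_def)
    also have "\<dots> \<le> (\<Sum>p\<in>T. \<Sum>k. ?f p k (\<gamma> t))" using hit T by (intro member_le_sum) auto
    also have "\<dots> \<le> inv_dist_majorant N T (\<gamma> t)" by (auto simp: inv_dist_majorant_def)
    finally show ?thesis using True by auto
  next
    case False
    then have "t \<notin> I k" for k using Isub[of k] by blast
    then show ?thesis by auto
  qed
  then have "(\<integral>\<^sup>+t. (\<Sum>k. ennreal (2^(k+1) * N) * indicator (I k) t) \<partial>lborel)
      \<le> (\<integral>\<^sup>+t\<in>{a..b}. inv_dist_majorant N T (\<gamma> t) \<partial>lborel)" by (intro nn_integral_mono) auto
  moreover have "(\<integral>\<^sup>+t. (\<Sum>k. ennreal (2^(k+1) * N) * indicator (I k) t) \<partial>lborel)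
      = (\<Sum>k. ennreal (2^(k+1) * N) * ennreal (h k))"
    by (subst nn_integral_suminf) (auto simp: nn_integral_cmult_indicator emI)
  moreover have "(\<Sum>k::nat. ennreal c) \<le> (\<Sum>k. ennreal (2^(k+1) * N) * ennreal (h k))"
    using hc N h by (intro suminf_le) (auto simp: ennreal_mult[symmetric] less_imp_le intro!: ennreal_leI)
  moreover have "(\<Sum>k::nat. ennreal c) = \<infinity>"
  proof (rule ccontr)
    assume "(\<Sum>k::nat. ennreal c) \<noteq> \<infinity>"
    then have "summable (\<lambda>_::nat. c)" using c by (intro summable_suminf_not_top) auto
    then show False using c by (simp add: summable_const_iff)
  qed
  ultimately show ?thesis by (simp add: top_unique)
qed

section \<open>Families of plane curves that are Lipschitz from below in the parameter\<close>

lemma holomorphic_remainder_lipschitz: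
  fixes Q :: "complex \<Rightarrow> complex"
  assumes Q: "Q holomorphic_on ball 0 R" and R: "R > 0" and e: "e > 0"
  shows "\<exists>r>0. r < R \<and> (\<forall>w\<in>cball 0 r. \<forall>w'\<in>cball 0 r.
    norm ((Q w - Q 0 - deriv Q 0 * w) - (Q w' - Q 0 - deriv Q 0 * w')) \<le> e * norm (w - w'))"
proof -
  have "continuous_on (ball 0 R) (deriv Q)"
    by (intro holomorphic_on_imp_continuous_on holomorphic_deriv Q open_ball)
  then obtain d where d: "d > 0" "\<And>z. z \<in> ball 0 R \<Longrightarrow> dist z 0 < d \<Longrightarrow> dist (deriv Q z) (deriv Q 0) < e"
    using R e unfolding continuous_on_iff by (metis centre_in_ball)
  define r where "r = min d R / 2"
  have r: "r > 0" "r < R" "r < d" using d R by (auto simp: r_def min_def)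
  have "norm ((Q w - Q 0 - deriv Q 0 * w) - (Q w' - Q 0 - deriv Q 0 * w')) \<le> e * norm (w - w')"
    if "w \<in> cball 0 r" "w' \<in> cball 0 r" for w w'
  proof (rule field_differentiable_bound[OF convex_cball[of 0 r]])
    fix z :: complex assume z: "z \<in> cball 0 r"
    then have zR: "z \<in> ball 0 R" using r by auto
    have "(Q has_field_derivative deriv Q z) (at z within cball 0 r)"
      by (rule holomorphic_derivI[OF Q open_ball zR])
    then show "((\<lambda>w. Q w - Q 0 - deriv Q 0 * w) has_field_derivative deriv Q z - deriv Q 0) (at z within cball 0 r)"
      by (auto intro!: derivative_eq_intros)
    show "norm (deriv Q z - deriv Q 0) \<le> e"
      using d(2)[OF zR] z r by (auto simp: dist_norm)
  qed (use that in auto)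
  then show ?thesis using r by blast
qed

text \<open>The straight interpolation from \<open>Q0\<close> to \<open>Q1\<close> is degenerate for some \<open>\<tau>\<close> when the quotient of their derivatives at
\<open>0\<close> is negative. Therefore only the nonlinear remainders, which have a small Lipschitz constant near
\<open>0\<close>, are interpolated linearly; the linear parts are joined by \<open>exp ((1 - \<tau>) * l0 + \<tau> * l1)\<close>, which never
vanishes.\<close>

lemma lower_lipschitz_edge_family:
  fixes c c' :: "real \<Rightarrow> complex" and Q0 Q1 :: "complex \<Rightarrow> complex"
  assumes ab: "a < b" and R: "R > 0"
    and c: "\<And>t. t \<in> {a..b} \<Longrightarrow> (c has_vector_derivative c' t) (at t within {a..b})"
      "continuous_on {a..b} c'" "open U" "c ` {a..b} \<subseteq> U"
    and Q0: "Q0 holomorphic_on ball 0 R" "deriv Q0 0 \<noteq> 0" "Q0 0 = c a"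
    and Q1: "Q1 holomorphic_on ball 0 R" "deriv Q1 0 \<noteq> 0" "Q1 0 = c b"
  obtains r m X X' where "r > 0" "r < R" "m > 0"
    "\<And>t w. t \<in> {a..b} \<Longrightarrow> w \<in> cball 0 r \<Longrightarrow> X t w \<in> U"
    "\<And>w. w \<in> cball 0 r \<Longrightarrow> X a w = Q0 w" "\<And>w. w \<in> cball 0 r \<Longrightarrow> X b w = Q1 w"
    "\<And>t. t \<in> {a..b} \<Longrightarrow> X t 0 = c t"
    "continuous_on ({a..b} \<times> cball 0 r) (\<lambda>(t, w). X t w)"
    "continuous_on ({a..b} \<times> cball 0 r) (\<lambda>(t, w). X' t w)"
    "\<And>t w. t \<in> {a..b} \<Longrightarrow> w \<in> cball 0 r \<Longrightarrow> ((\<lambda>t. X t w) has_vector_derivative X' t w) (at t within {a..b})"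
    "\<And>t w w'. t \<in> {a..b} \<Longrightarrow> w \<in> cball 0 r \<Longrightarrow> w' \<in> cball 0 r \<Longrightarrow> m * dist w w' \<le> dist (X t w) (X t w')"
proof -
  define l0 l1 where "l0 = Ln (deriv Q0 0)" and "l1 = Ln (deriv Q1 0)"
  have el: "exp l0 = deriv Q0 0" "exp l1 = deriv Q1 0" using Q0 Q1 by (auto simp: l0_def l1_def)
  define \<tau> where "\<tau> t = (t - a) / (b - a)" for t
  have \<tau>: "\<tau> t \<in> {0..1}" if "t \<in> {a..b}" for t using that ab by (auto simp: \<tau>_def)
  have \<tau>ab: "\<tau> a = 0" "\<tau> b = 1" using ab by (auto simp: \<tau>_def)
  have d\<tau>: "(\<tau> has_real_derivative 1 / (b - a)) (at t within S)" for t S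
    unfolding \<tau>_def using ab by (auto intro!: derivative_eq_intros)
  have cont\<tau>: "continuous_on S \<tau>" for S unfolding \<tau>_def using ab by (intro continuous_intros) auto
  define \<Lambda> where "\<Lambda> t = exp ((1 - of_real (\<tau> t)) * l0 + of_real (\<tau> t) * l1)" for t
  define F where "F Q w = Q w - Q 0 - deriv Q 0 * w" for Q :: "complex \<Rightarrow> complex" and w
  have F0: "F Q 0 = 0" for Q by (simp add: F_def)
  \<comment> \<open>The factor \<open>\<Lambda>\<close> has modulus at least \<open>2 * m\<close>, and the remainders may use up \<open>m\<close> of it.\<close>
  define m where "m = exp (min (Re l0) (Re l1)) / 2"
  have m: "m > 0" by (simp add: m_def)
  define M where "M = exp (max (Re l0) (Re l1)) + m"
  have M: "M > 0" using m by (simp add: M_def add_pos_pos)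
  have \<Lambda>: "2 * m \<le> norm (\<Lambda> t)" "norm (\<Lambda> t) \<le> M - m" if "t \<in> {a..b}" for t
  proof -
    have n: "norm (\<Lambda> t) = exp ((1 - \<tau> t) * Re l0 + \<tau> t * Re l1)" by (simp add: \<Lambda>_def)
    have "(1 - \<tau> t) * min (Re l0) (Re l1) + \<tau> t * min (Re l0) (Re l1) \<le> (1 - \<tau> t) * Re l0 + \<tau> t * Re l1"
      using \<tau>[OF that] by (intro add_mono mult_left_mono) auto
    then show "2 * m \<le> norm (\<Lambda> t)" unfolding n m_def by (simp add: algebra_simps)
    have "(1 - \<tau> t) * Re l0 + \<tau> t * Re l1 \<le> (1 - \<tau> t) * max (Re l0) (Re l1) + \<tau> t * max (Re l0) (Re l1)"
      using \<tau>[OF that] by (intro add_mono mult_left_mono) auto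
    then show "norm (\<Lambda> t) \<le> M - m" unfolding n M_def by (simp add: algebra_simps)
  qed
  obtain r0 where r0: "r0 > 0" "r0 < R" "\<And>w w'. w \<in> cball 0 r0 \<Longrightarrow> w' \<in> cball 0 r0 \<Longrightarrow>
      norm (F Q0 w - F Q0 w') \<le> m * norm (w - w')"
    using holomorphic_remainder_lipschitz[OF Q0(1) R m] unfolding F_def by metis
  obtain r1 where r1: "r1 > 0" "r1 < R" "\<And>w w'. w \<in> cball 0 r1 \<Longrightarrow> w' \<in> cball 0 r1 \<Longrightarrow>
      norm (F Q1 w - F Q1 w') \<le> m * norm (w - w')"
    using holomorphic_remainder_lipschitz[OF Q1(1) R m] unfolding F_def by metis
  have contc: "continuous_on {a..b} c"
    using c(1) by (meson continuous_on_eq_continuous_within has_vector_derivative_continuous)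
  obtain e where e: "e > 0" "{x. infdist x (c ` {a..b}) \<le> e} \<subseteq> U"
    using compact_in_open_separated[of "c ` {a..b}" U] ab c compact_continuous_image[OF contc] by auto
  define r where "r = min (min r0 r1) (e / M)"
  have "r > 0" "r \<le> r0" "r \<le> r1" "r \<le> e / M" using r0 r1 e M by (auto simp: r_def)
  then have r: "r > 0" "r \<le> r0" "r \<le> r1" "r * M \<le> e" using M by (auto simp: pos_le_divide_eq)
  have F_lip: "norm (F Q0 w - F Q0 w') \<le> m * norm (w - w')" "norm (F Q1 w - F Q1 w') \<le> m * norm (w - w')"
    if "w \<in> cball 0 r" "w' \<in> cball 0 r" for w w'
    using that r r0(3)[of w w'] r1(3)[of w w'] by auto
  have contF: "continuous_on (cball 0 r) (F Q0)" "continuous_on (cball 0 r) (F Q1)"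
    using r r0 r1 Q0(1) Q1(1) unfolding F_def
    by (auto intro!: continuous_intros elim!: continuous_on_subset[OF holomorphic_on_imp_continuous_on])
  define rem where "rem t w = (1 - of_real (\<tau> t)) * F Q0 w + of_real (\<tau> t) * F Q1 w" for t w
  have rem: "norm (rem t w - rem t w') \<le> m * norm (w - w')"
    if "t \<in> {a..b}" "w \<in> cball 0 r" "w' \<in> cball 0 r" for t w w'
  proof -
    have "rem t w - rem t w' = of_real (1 - \<tau> t) * (F Q0 w - F Q0 w') + of_real (\<tau> t) * (F Q1 w - F Q1 w')"
      by (simp add: rem_def algebra_simps)
    also have "norm \<dots> \<le> (1 - \<tau> t) * norm (F Q0 w - F Q0 w') + \<tau> t * norm (F Q1 w - F Q1 w')"
      using \<tau>[OF that(1)] by (intro order_trans[OF norm_triangle_ineq]) (simp add: norm_mult del: of_real_diff)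
    also have "\<dots> \<le> (1 - \<tau> t) * (m * norm (w - w')) + \<tau> t * (m * norm (w - w'))"
      using \<tau>[OF that(1)] F_lip[OF that(2,3)] by (intro add_mono mult_left_mono) auto
    finally show ?thesis by (simp add: algebra_simps)
  qed
  define X where "X t w = c t + \<Lambda> t * w + rem t w" for t w
  define X' where "X' t w = c' t + \<Lambda> t * ((l1 - l0) / of_real (b - a)) * w + (F Q1 w - F Q0 w) / of_real (b - a)" for t w
  have cont\<Lambda>: "continuous_on {a..b} \<Lambda>" unfolding \<Lambda>_def by (intro continuous_intros cont\<tau>)
  have contfst: "continuous_on ({a..b} \<times> cball 0 r) (\<lambda>p. g (fst p))" if "continuous_on {a..b} g"
    for g :: "real \<Rightarrow> 'z::topological_space"
    by (rule continuous_on_compose2[OF that]) (auto intro: continuous_intros)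
  have contsnd: "continuous_on ({a..b} \<times> cball 0 r) (\<lambda>p. g (snd p))" if "continuous_on (cball 0 r) g"
    for g :: "complex \<Rightarrow> complex"
    by (rule continuous_on_compose2[OF that]) (auto intro: continuous_intros)
  show thesis
  proof (rule that[of r m X X'])
    show "r > 0" "r < R" "m > 0" using r r0 m by auto
    show "X t w \<in> U" if t: "t \<in> {a..b}" and w: "w \<in> cball 0 r" for t w
    proof -
      have "norm (X t w - c t) \<le> norm (\<Lambda> t) * norm w + norm (rem t w - rem t 0)"
        using norm_triangle_ineq[of "\<Lambda> t * w" "rem t w"] by (simp add: X_def rem_def F0 norm_mult)
      also have "\<dots> \<le> (M - m) * norm w + m * norm (w - 0)"
        using \<Lambda>[OF t] r by (intro add_mono mult_right_mono rem t w) auto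
      also have "\<dots> = norm w * M" by (simp add: algebra_simps)
      also have "\<dots> \<le> r * M" using w M by (intro mult_right_mono) auto
      also have "\<dots> \<le> e" by (rule r)
      finally have "infdist (X t w) (c ` {a..b}) \<le> e"
        using infdist_le[of "c t" "c ` {a..b}" "X t w"] t by (auto simp: dist_norm)
      then show ?thesis using e by auto
    qed
    show "X a w = Q0 w" "X b w = Q1 w" for w
      using Q0 Q1 by (auto simp: X_def \<Lambda>_def \<tau>ab rem_def F_def el)
    show "X t 0 = c t" for t by (simp add: X_def rem_def F0)
    show "continuous_on ({a..b} \<times> cball 0 r) (\<lambda>(t, w). X t w)"
      unfolding X_def rem_def case_prod_unfold
      by (intro continuous_intros contfst contsnd contc cont\<Lambda> contF cont\<tau>)
    show "continuous_on ({a..b} \<times> cball 0 r) (\<lambda>(t, w). X' t w)"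
      unfolding X'_def case_prod_unfold using ab
      by (intro continuous_intros contfst contsnd c cont\<Lambda> contF) auto
    show "((\<lambda>t. X t w) has_vector_derivative X' t w) (at t within {a..b})" if t: "t \<in> {a..b}" for t w
    proof -
      have d\<tau>': "((\<lambda>t. of_real (\<tau> t) :: complex) has_vector_derivative of_real (1 / (b - a))) (at t within {a..b})"
        using d\<tau> by (intro has_vector_derivative_of_real) (simp add: has_real_derivative_iff_has_vector_derivative)
      have "((\<lambda>t. (1 - of_real (\<tau> t)) * l0 + of_real (\<tau> t) * l1) has_vector_derivative
          (- of_real (1 / (b - a))) * l0 + of_real (1 / (b - a)) * l1) (at t within {a..b})"
        by (rule has_vector_derivative_eq_rhs, (rule derivative_intros d\<tau>')+) simp
      then have "((exp \<circ> (\<lambda>t. (1 - of_real (\<tau> t)) * l0 + of_real (\<tau> t) * l1)) has_vector_derivative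
          ((- of_real (1 / (b - a))) * l0 + of_real (1 / (b - a)) * l1) * \<Lambda> t) (at t within {a..b})"
        unfolding \<Lambda>_def by (rule field_vector_diff_chain_within) (auto intro!: derivative_eq_intros)
      then have d\<Lambda>: "(\<Lambda> has_vector_derivative \<Lambda> t * ((l1 - l0) / of_real (b - a))) (at t within {a..b})"
        by (simp add: \<Lambda>_def[abs_def] o_def algebra_simps diff_divide_distrib)
      show ?thesis unfolding X_def rem_def X'_def
        by (rule has_vector_derivative_eq_rhs, (rule derivative_intros d\<tau>' d\<Lambda> c t)+)
           (simp add: diff_divide_distrib)
    qed
    show "m * dist w w' \<le> dist (X t w) (X t w')"
      if t: "t \<in> {a..b}" and w: "w \<in> cball 0 r" "w' \<in> cball 0 r" for t w w'
    proof -
      have "X t w - X t w' = \<Lambda> t * (w - w') + (rem t w - rem t w')" by (simp add: X_def algebra_simps)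
      then have "norm (X t w - X t w') \<ge> norm (\<Lambda> t) * norm (w - w') - norm (rem t w - rem t w')"
        by (metis norm_diff_ineq norm_mult)
      moreover have "2 * m * norm (w - w') \<le> norm (\<Lambda> t) * norm (w - w')"
        using \<Lambda>[OF t] by (intro mult_right_mono) auto
      ultimately show ?thesis using rem[OF t w] by (simp add: dist_norm)
    qed
  qed
qed

lemma has_vector_derivative_imp_lipschitz:
  fixes f :: "real \<Rightarrow> 'b::real_normed_vector"
  assumes "\<And>t. t \<in> {a..b} \<Longrightarrow> (f has_vector_derivative f' t) (at t within {a..b})"
    and "\<And>t. t \<in> {a..b} \<Longrightarrow> norm (f' t) \<le> V" and "s \<in> {a..b}" "t \<in> {a..b}"
  shows "dist (f s) (f t) \<le> V * \<bar>t - s\<bar>"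
proof -
  have "norm (f t - f s) \<le> V * norm (t - s)"
  proof (rule differentiable_bound[OF convex_real_interval(5)[of a b]])
    fix x assume x: "x \<in> {a..b}"
    show "(f has_derivative (\<lambda>h. h *\<^sub>R f' x)) (at x within {a..b})"
      using assms(1)[OF x] by (simp add: has_vector_derivative_def)
    show "onorm (\<lambda>h. h *\<^sub>R f' x) \<le> V"
      using assms(2)[OF x] by (intro onorm_le) (simp add: mult.commute[of V] mult_left_mono)
  qed (use assms in auto)
  then show ?thesis by (simp add: dist_norm norm_minus_commute)
qed

text \<open>\<open>M w\<close> integrates the pointwise bound for the Kobayashi--Royden metric along the curve of parameter \<open>w\<close>,
where \<open>V\<close> bounds the speed and \<open>\<epsilon>\<close> is the distance to the boundary of the chart. After exchanging the
integrals, the inner one runs over \<open>w\<close> at fixed \<open>t\<close>, where the family is Lipschitz from below.\<close>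

lemma average_cost_of_family:
  fixes X :: "real \<Rightarrow> complex \<Rightarrow> complex"
  assumes ab: "a < b" and r: "r > 0" and m: "m > 0" and \<epsilon>: "\<epsilon> > 0" and V: "V > 0"
    and T: "finite T" "real (card T) \<le> N\<^sup>2" and N: "N \<ge> 1"
    and cont: "continuous_on ({a..b} \<times> cball 0 r) (\<lambda>(t, w). X t w)"
    and expand: "\<And>t w w'. t \<in> {a..b} \<Longrightarrow> w \<in> cball 0 r \<Longrightarrow> w' \<in> cball 0 r \<Longrightarrow>
       m * dist w w' \<le> dist (X t w) (X t w')"
    and lip: "\<And>s t w. s \<in> {a..b} \<Longrightarrow> t \<in> {a..b} \<Longrightarrow> w \<in> cball 0 r \<Longrightarrow>
       dist (X s w) (X t w) \<le> V * \<bar>t - s\<bar>"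
  shows "\<exists>M\<in>borel_measurable borel.
    (\<integral>\<^sup>+w\<in>cball 0 r. M w \<partial>lborel)
       \<le> ennreal (2 * V * (b - a) * ((1 / \<epsilon> + 1) * (pi * r\<^sup>2) + 16 * pi / m\<^sup>2) * N) \<and>
    (\<forall>w\<in>cball 0 r. M w = (\<integral>\<^sup>+t\<in>{a..b}. ennreal (2 * V) * (ennreal (1 / \<epsilon>) + inv_dist_majorant N T (X t w)) \<partial>lborel) \<and>
       (M w < \<infinity> \<longrightarrow> (\<forall>t\<in>{a..b}. X t w \<notin> T)))"
proof -
  let ?W = "cball 0 r :: complex set"
  \<comment> \<open>Extending \<open>X\<close> by \<open>0\<close> gives a Borel function on the whole product, as Tonelli requires.\<close>
  define Y where "Y p = indicator ({a..b} \<times> ?W) p *\<^sub>R (case p of (t, w) \<Rightarrow> X t w)" for p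
  have "Y \<in> borel_measurable borel" unfolding Y_def
    by (intro borel_measurable_continuous_on_indicator cont borel_closed closed_Times) auto
  then have Y [measurable]: "Y \<in> borel_measurable (borel \<Otimes>\<^sub>M borel)" by (simp add: borel_prod)
  have YX: "Y (t, w) = X t w" if "t \<in> {a..b}" "w \<in> ?W" for t w using that by (simp add: Y_def)
  define g where "g t w = ennreal (2 * V) * (ennreal (1 / \<epsilon>) + inv_dist_majorant N T (Y (t, w)))" for t w
  have [measurable]: "(\<lambda>p. g (fst p) (snd p)) \<in> borel_measurable (borel \<Otimes>\<^sub>M borel)" unfolding g_def by measurable
  have g1 [measurable]: "(\<lambda>w. g t w) \<in> borel_measurable borel" for t unfolding g_def by measurable
  have W [measurable]: "?W \<in> sets borel" by simp
  define M where "M w = (\<integral>\<^sup>+t\<in>{a..b}. g t w \<partial>lborel)" for w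
  have M: "M \<in> borel_measurable borel" unfolding M_def g_def by measurable
  define D where "D = 2 * V * ((1 / \<epsilon> + 1) * (pi * r\<^sup>2) + 16 * pi / m\<^sup>2) * N"
  have D: "D \<ge> 0" using V \<epsilon> N m by (auto simp: D_def intro!: mult_nonneg_nonneg add_nonneg_nonneg)
  have emW: "emeasure lborel ?W = ennreal (pi * r\<^sup>2)"
    using r by (subst emeasure_cball) (auto simp: unit_ball_vol_2)
  have collect: "ennreal p * (ennreal q * ennreal x + (ennreal n * ennreal x + ennreal y))
      = ennreal (p * (q * x + (n * x + y)))"
    if "p \<ge> 0" "q \<ge> 0" "x \<ge> 0" "n \<ge> 0" "y \<ge> 0" for p q x n y :: real
    using that by (simp add: ennreal_mult)
  have inner: "(\<integral>\<^sup>+w\<in>?W. g t w \<partial>lborel) \<le> ennreal D" if t: "t \<in> {a..b}" for t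
  proof -
    have "(\<integral>\<^sup>+w\<in>?W. g t w \<partial>lborel) = (\<integral>\<^sup>+w. ennreal (2 * V) * (ennreal (1 / \<epsilon>) * indicator ?W w
        + inv_dist_majorant N T (Y (t, w)) * indicator ?W w) \<partial>lborel)"
      by (intro nn_integral_cong) (auto simp: g_def indicator_def)
    also have "\<dots> = ennreal (2 * V) * (ennreal (1 / \<epsilon>) * emeasure lborel ?W
        + (\<integral>\<^sup>+w\<in>?W. inv_dist_majorant N T (Y (t, w)) \<partial>lborel))"
      by (subst nn_integral_cmult, measurable, subst nn_integral_add) (auto simp: nn_integral_cmult_indicator)
    also have "\<dots> \<le> ennreal (2 * V) * (ennreal (1 / \<epsilon>) * emeasure lborel ?W
        + (ennreal N * emeasure lborel ?W + ennreal (16 * pi / m\<^sup>2 * N)))"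
      using expand[OF t] m N T t
      by (intro mult_left_mono add_left_mono nn_integral_inv_dist_majorant_le) (auto simp: YX)
    also have "\<dots> = ennreal (2 * V * (1 / \<epsilon> * (pi * r\<^sup>2) + (N * (pi * r\<^sup>2) + 16 * pi / m\<^sup>2 * N)))"
      unfolding emW using V \<epsilon> N m by (intro collect) auto
    also have "\<dots> \<le> ennreal D"
    proof (rule ennreal_leI)
      have "1 / \<epsilon> * (pi * r\<^sup>2) * 1 \<le> 1 / \<epsilon> * (pi * r\<^sup>2) * N"
        using N \<epsilon> by (intro mult_left_mono) auto
      then have "1 / \<epsilon> * (pi * r\<^sup>2) + (N * (pi * r\<^sup>2) + 16 * pi / m\<^sup>2 * N)
         \<le> ((1 / \<epsilon> + 1) * (pi * r\<^sup>2) + 16 * pi / m\<^sup>2) * N" by (simp add: algebra_simps)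
      from mult_left_mono[OF this, of "2 * V"] V show "2 * V * (1 / \<epsilon> * (pi * r\<^sup>2) + (N * (pi * r\<^sup>2) + 16 * pi / m\<^sup>2 * N)) \<le> D"
        by (simp only: D_def mult.assoc)
    qed
    finally show ?thesis .
  qed
  have "(\<integral>\<^sup>+w\<in>?W. M w \<partial>lborel) = (\<integral>\<^sup>+w. \<integral>\<^sup>+t. g t w * indicator {a..b} t * indicator ?W w \<partial>lborel \<partial>lborel)"
    unfolding M_def by (subst nn_integral_multc) (auto simp: g_def)
  also have "\<dots> = (\<integral>\<^sup>+t. \<integral>\<^sup>+w. g t w * indicator {a..b} t * indicator ?W w \<partial>lborel \<partial>lborel)"
    by (rule lborel_pair.Fubini') (simp add: g_def case_prod_unfold)
  also have "\<dots> \<le> (\<integral>\<^sup>+t. ennreal D * indicator {a..b} t \<partial>lborel)"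
  proof (rule nn_integral_mono)
    fix t
    show "(\<integral>\<^sup>+w. g t w * indicator {a..b} t * indicator ?W w \<partial>lborel) \<le> ennreal D * indicator {a..b} t"
      using inner[of t] by (cases "t \<in> {a..b}") auto
  qed
  also have "\<dots> = ennreal (D * (b - a))"
    using ab D by (subst nn_integral_cmult_indicator) (auto simp: ennreal_mult)
  finally have int: "(\<integral>\<^sup>+w\<in>?W. M w \<partial>lborel) \<le> ennreal (D * (b - a))" .
  have Mw: "M w = (\<integral>\<^sup>+t\<in>{a..b}. ennreal (2 * V) * (ennreal (1 / \<epsilon>) + inv_dist_majorant N T (X t w)) \<partial>lborel)"
    if "w \<in> ?W" for w
    unfolding M_def g_def by (intro nn_integral_cong) (use that in \<open>auto simp: indicator_def YX\<close>)
  have "X t0 w \<notin> T" if w: "w \<in> ?W" and fin: "M w < \<infinity>" and t0: "t0 \<in> {a..b}" for w t0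
  proof
    assume hit: "X t0 w \<in> T"
    have "(\<integral>\<^sup>+t\<in>{a..b}. inv_dist_majorant N T (Y (t, w)) \<partial>lborel) = (\<integral>\<^sup>+t\<in>{a..b}. inv_dist_majorant N T (X t w) \<partial>lborel)"
      by (intro nn_integral_cong) (use w in \<open>auto simp: indicator_def YX\<close>)
    also have "\<dots> = \<infinity>"
      using N by (intro nn_integral_inv_dist_majorant_eq_top[where \<gamma> = "\<lambda>t. X t w", OF ab t0 hit T(1) _ V] lip t0 w) auto
    finally have hit_top: "\<infinity> = (\<integral>\<^sup>+t\<in>{a..b}. inv_dist_majorant N T (Y (t, w)) \<partial>lborel)" by simp
    then have "\<infinity> = ennreal (2 * V) * (\<integral>\<^sup>+t\<in>{a..b}. inv_dist_majorant N T (Y (t, w)) \<partial>lborel)"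
      unfolding hit_top[symmetric] using V by (simp add: ennreal_mult_top)
    also have "\<dots> = (\<integral>\<^sup>+t\<in>{a..b}. ennreal (2 * V) * inv_dist_majorant N T (Y (t, w)) \<partial>lborel)"
      by (subst nn_integral_cmult[symmetric]) (auto simp: mult.assoc)
    also have "\<dots> \<le> M w" unfolding M_def g_def
      by (intro nn_integral_mono mult_right_mono mult_left_mono) auto
    finally show False using fin by (simp add: top_unique)
  qed
  then have "\<forall>w\<in>?W. M w < \<infinity> \<longrightarrow> (\<forall>t\<in>{a..b}. X t w \<notin> T)" by blast
  moreover have "D * (b - a) = 2 * V * (b - a) * ((1 / \<epsilon> + 1) * (pi * r\<^sup>2) + 16 * pi / m\<^sup>2) * N"
    by (simp only: D_def mult_ac)
  ultimately show ?thesis using int Mw by (intro bexI[OF _ M] conjI ballI) (simp only:, blast+)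
qed

lemma compact_image_bound:
  fixes f :: "'x::topological_space \<Rightarrow> 'y::real_normed_vector"
  assumes "compact K" "continuous_on K f"
  obtains V where "V > 0" "\<And>x. x \<in> K \<Longrightarrow> norm (f x) \<le> V"
proof -
  have "bounded (f ` K)" using assms by (intro compact_imp_bounded compact_continuous_image)
  then obtain V where "\<forall>y\<in>f ` K. norm y \<le> V" by (auto simp: bounded_iff)
  then show thesis by (intro that[of "max V 1"]) auto
qed

section \<open>Calculus in the charts of a compact Riemann surface\<close>

locale riemann_surface =
  fixes A :: "('a::t2_space) atlas"
  assumes surface: "compact_riemann_surface A"
begin

abbreviation inv_chart :: "'a chart \<Rightarrow> complex \<Rightarrow> 'a" where
  "inv_chart c \<equiv> inv_into (fst c) (snd c)"

lemma chart_exists: "\<exists>c\<in>A. x \<in> fst c"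
  using surface by (auto simp: compact_riemann_surface_def)

lemma chart:
  assumes "c \<in> A"
  shows open_chart: "open (fst c)" and open_chart_image: "open (snd c ` fst c)"
    and chart_homeomorphism: "homeomorphism (fst c) (snd c ` fst c) (snd c) (inv_chart c)"
  using surface assms by (auto simp: compact_riemann_surface_def case_prod_unfold)

lemma inv_chart_chart [simp]: "c \<in> A \<Longrightarrow> x \<in> fst c \<Longrightarrow> inv_chart c (snd c x) = x"
  using chart_homeomorphism by (auto simp: homeomorphism_def)

lemma chart_inv_chart: "c \<in> A \<Longrightarrow> z \<in> snd c ` fst c \<Longrightarrow> snd c (inv_chart c z) = z"
  by (rule f_inv_into_f)

lemma inv_chart_in: "z \<in> snd c ` fst c \<Longrightarrow> inv_chart c z \<in> fst c"
  by (rule inv_into_into)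

lemma continuous_on_inv_chart: "c \<in> A \<Longrightarrow> continuous_on (snd c ` fst c) (inv_chart c)"
  using chart_homeomorphism by (auto simp: homeomorphism_def)

lemma open_chart_subimage:
  assumes "c \<in> A" "open U"
  shows "open (snd c ` (fst c \<inter> U))"
proof -
  have "openin (top_of_set (snd c ` fst c)) (snd c ` (fst c \<inter> U))"
    using homeomorphism_imp_open_map[OF chart_homeomorphism[OF assms(1)]] assms(2)
    by (metis openin_open_Int)
  then show ?thesis using open_chart_image[OF assms(1)] openin_open_eq by blast
qed

lemma transition_apply: "c \<in> A \<Longrightarrow> x \<in> fst c \<Longrightarrow> transition c d (snd c x) = snd d x"
  by (simp add: transition_def)

lemma transition_holomorphic:
  "c \<in> A \<Longrightarrow> d \<in> A \<Longrightarrow> transition c d holomorphic_on snd c ` (fst c \<inter> fst d)"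
  using surface by (auto simp: compact_riemann_surface_def)

lemma open_transition_domain: "c \<in> A \<Longrightarrow> d \<in> A \<Longrightarrow> open (snd c ` (fst c \<inter> fst d))"
  by (intro open_chart_subimage open_chart)

lemma transition_has_deriv:
  assumes "c \<in> A" "d \<in> A" "x \<in> fst c" "x \<in> fst d"
  shows "(transition c d has_field_derivative deriv (transition c d) (snd c x)) (at (snd c x))"
  using assms
  by (intro holomorphic_derivI[OF transition_holomorphic open_transition_domain]) auto

lemma deriv_transition_cocycle:
  assumes "c \<in> A" "d \<in> A" "e \<in> A" "x \<in> fst c" "x \<in> fst d" "x \<in> fst e"
  shows "deriv (transition c e) (snd c x)
           = deriv (transition d e) (snd d x) * deriv (transition c d) (snd c x)"
proof -
  have "(transition d e has_field_derivative deriv (transition d e) (snd d x))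
     (at (transition c d (snd c x)))"
    using transition_has_deriv[of d e x] assms by (simp add: transition_apply)
  then have "((transition d e \<circ> transition c d) has_field_derivative
     deriv (transition d e) (snd d x) * deriv (transition c d) (snd c x)) (at (snd c x))"
    using assms by (intro DERIV_chain transition_has_deriv) auto
  then have "(transition c e has_field_derivative
     deriv (transition d e) (snd d x) * deriv (transition c d) (snd c x)) (at (snd c x))"
  proof (rule has_field_derivative_transform_within_open)
    show "open (snd c ` (fst c \<inter> (fst d \<inter> fst e)))"
      using assms by (intro open_chart_subimage open_Int open_chart)
  qed (use assms in \<open>auto simp: transition_apply\<close>)
  then show ?thesis by (rule DERIV_imp_deriv)
qed

lemma deriv_transition_self:
  assumes "c \<in> A" "x \<in> fst c"
  shows "deriv (transition c c) (snd c x) = 1"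
proof -
  have "((\<lambda>z. z) has_field_derivative 1) (at (snd c x))" by simp
  then have "(transition c c has_field_derivative 1) (at (snd c x))"
    by (rule has_field_derivative_transform_within_open[OF _ open_chart_image[OF assms(1)]])
       (use assms in \<open>auto simp: transition_apply\<close>)
  then show ?thesis by (rule DERIV_imp_deriv)
qed

lemma deriv_transition_nonzero:
  assumes "c \<in> A" "d \<in> A" "x \<in> fst c" "x \<in> fst d"
  shows "deriv (transition c d) (snd c x) \<noteq> 0"
  using deriv_transition_cocycle[of c d c x] deriv_transition_self[of c x] assms by auto

lemma tvec_of_coord_in_tangent_space:
  assumes "c \<in> A" "x \<in> fst c"
  shows "tvec_of_coord A x c v \<in> tangent_space A x"
  unfolding tangent_space_def
proof (intro CollectI conjI allI ballI impI)
  fix d e assume "d \<in> A" "e \<in> A" "x \<in> fst d \<and> x \<in> fst e"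
  then show "tvec_of_coord A x c v e = deriv (transition d e) (snd d x) * tvec_of_coord A x c v d"
    using deriv_transition_cocycle[of c d e x] assms by (simp add: tvec_of_coord_def)
qed (auto simp: tvec_of_coord_def)

text \<open>A tangent vector lists its coordinates in all charts; the chain rule reduces it to a single one.\<close>

lemma velocity_eq_tvec_of_coord:
  assumes c: "c \<in> A" and ab: "0 \<le> a" "b \<le> 1" and t: "t \<in> {a<..<b}"
    and C: "continuous_on {a<..<b} C" "(C has_vector_derivative v) (at t)"
    and \<gamma>: "\<And>t. t \<in> {a<..<b} \<Longrightarrow> \<gamma> t \<in> fst c \<and> snd c (\<gamma> t) = C t"
  shows "velocity A \<gamma> t = tvec_of_coord A (\<gamma> t) c v"
proof
  fix d
  show "velocity A \<gamma> t d = tvec_of_coord A (\<gamma> t) c v d"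
  proof (cases "d \<in> A \<and> \<gamma> t \<in> fst d")
    case False
    then show ?thesis by (auto simp: velocity_def tvec_of_coord_def)
  next
    case True
    let ?W = "snd c ` (fst c \<inter> fst d)"
    define I where "I = {a<..<b} \<inter> C -` ?W"
    have I: "open I" unfolding I_def
      using C(1) open_transition_domain[OF c] True
      by (intro continuous_open_preimage) auto
    have "C t = snd c (\<gamma> t)" using \<gamma> t by simp
    then have tI: "t \<in> I" using t \<gamma>[of t] True by (auto simp: I_def)
    have "((transition c d \<circ> C) has_vector_derivative v * deriv (transition c d) (snd c (\<gamma> t))) (at t)"
      using C(2) transition_has_deriv[of c d "\<gamma> t"] c True \<gamma> t
      by (intro field_vector_diff_chain_at) auto
    then have "((snd d \<circ> \<gamma>) has_vector_derivative v * deriv (transition c d) (snd c (\<gamma> t))) (at t)"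
    proof (rule has_vector_derivative_transform_within_open[OF _ I tI])
      fix s assume s: "s \<in> I"
      then have "\<gamma> s \<in> fst c" "snd c (\<gamma> s) = C s" using \<gamma> by (auto simp: I_def)
      then show "(transition c d \<circ> C) s = (snd d \<circ> \<gamma>) s"
        using transition_apply[OF c, of "\<gamma> s" d] by simp
    qed
    then have "vector_derivative (snd d \<circ> \<gamma>) (at t within {0..1})
        = v * deriv (transition c d) (snd c (\<gamma> t))"
      using t ab by (intro vector_derivative_at_within_ivl) auto
    then show ?thesis using True by (auto simp: velocity_def tvec_of_coord_def)
  qed
qed

lemma C1_curve_on_inv_chart:
  assumes c: "c \<in> A"
    and C: "\<And>t. t \<in> I \<Longrightarrow> C t \<in> snd c ` fst c"
      "\<And>t. t \<in> I \<Longrightarrow> (C has_vector_derivative C' t) (at t within I)" "continuous_on I C'"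
    and \<gamma>: "\<And>t. t \<in> I \<Longrightarrow> \<gamma> t = inv_chart c (C t)"
  shows "C1_curve_on A I \<gamma>"
  unfolding C1_curve_on_def
proof (intro conjI ballI, goal_cases)
  have contC: "continuous_on I C"
    using C(2) by (meson continuous_on_eq_continuous_within has_vector_derivative_continuous)
  case 1
  have "continuous_on I (\<lambda>t. inv_chart c (C t))"
    using C(1) by (intro continuous_on_compose2[OF continuous_on_inv_chart[OF c] contC]) auto
  then show ?case using \<gamma> by (simp cong: continuous_on_cong)
  case (2 d)
  obtain U \<phi> where d: "d = (U, \<phi>)" by (cases d)
  have dA: "d \<in> A" by (rule 2)
  define J where "J = {t\<in>I. \<gamma> t \<in> U}"
  have J: "C t \<in> snd c ` (fst c \<inter> fst d)" if "t \<in> J" for t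
    using that C(1)[of t] \<gamma>[of t] inv_chart_in[of "C t" c] chart_inv_chart[OF c, of "C t"]
    by (auto simp: J_def d intro!: image_eqI[of _ _ "\<gamma> t"])
  have \<gamma>J: "(\<phi> \<circ> \<gamma>) t = (transition c d \<circ> C) t" if "t \<in> J" for t
    using that \<gamma> by (auto simp: transition_def d J_def)
  have "C1_within J (\<phi> \<circ> \<gamma>)"
    unfolding C1_within_def
  proof (intro exI[of _ "\<lambda>t. C' t * deriv (transition c d) (C t)"] conjI ballI)
    fix t assume t: "t \<in> J"
    have "(transition c d has_field_derivative deriv (transition c d) (C t)) (at (C t) within C ` J)"
      using holomorphic_derivI[OF transition_holomorphic[OF c dA] open_transition_domain[OF c dA] J[OF t]] .
    moreover have "(C has_vector_derivative C' t) (at t within J)"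
      using C(2)[of t] t by (auto simp: J_def intro: has_vector_derivative_within_subset)
    ultimately have "((transition c d \<circ> C) has_vector_derivative C' t * deriv (transition c d) (C t)) (at t within J)"
      by (intro field_vector_diff_chain_within)
    then show "((\<phi> \<circ> \<gamma>) has_vector_derivative C' t * deriv (transition c d) (C t)) (at t within J)"
      by (rule has_vector_derivative_transform[OF t \<gamma>J, rotated])
  next
    have "continuous_on (snd c ` (fst c \<inter> fst d)) (deriv (transition c d))"
      by (intro holomorphic_on_imp_continuous_on holomorphic_deriv transition_holomorphic
          open_transition_domain c dA)
    then have "continuous_on J (\<lambda>t. deriv (transition c d) (C t))"
      using contC J by (elim continuous_on_compose2) (auto simp: J_def intro: continuous_on_subset)
    then show "continuous_on J (\<lambda>t. C' t * deriv (transition c d) (C t))"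
      using C(3) by (intro continuous_intros) (auto simp: J_def intro: continuous_on_subset)
  qed
  then show ?case by (simp add: d J_def)
qed

text \<open>The test disk is \<open>z \<mapsto> x + v z\<close> in the chart, on the radius \<open>\<delta> / V\<close>. Bounding \<open>v\<close> by some \<open>V > 0\<close>
avoids a separate case for \<open>v = 0\<close>.\<close>

lemma kobayashi_royden_le:
  assumes c: "c \<in> A" and x: "x \<in> fst c" and \<delta>: "\<delta> > 0" and v: "V > 0" "norm v \<le> V"
    and sub: "ball (snd c x) \<delta> \<subseteq> snd c ` (fst c \<inter> X)"
  shows "kobayashi_royden A X x (tvec_of_coord A x c v) \<le> ennreal (2 * V / \<delta>)"
proof -
  define R where "R = \<delta> / V"
  have R: "R > 0" using \<delta> v by (simp add: R_def)
  define g where "g z = snd c x + v * z" for z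
  define f where "f z = inv_chart c (g z)" for z
  have g: "g z \<in> snd c ` (fst c \<inter> X)" if "z \<in> ball 0 R" for z
  proof -
    have "norm (v * z) \<le> V * norm z" using v by (simp add: norm_mult mult_right_mono)
    also have "\<dots> < V * R" using that v by simp
    finally have "g z \<in> ball (snd c x) \<delta>" using v by (simp add: g_def dist_norm R_def)
    then show ?thesis using sub by blast
  qed
  have f: "f z \<in> fst c" "f z \<in> X" "snd c (f z) = g z" if "z \<in> ball 0 R" for z
    using g[OF that] c by (auto simp: f_def)
  have f0: "f 0 = x" using c x by (simp add: f_def g_def)
  have contf: "continuous_on (ball 0 R) f" unfolding f_def
    by (rule continuous_on_compose2[OF continuous_on_inv_chart[OF c]])
       (use g in \<open>force simp: g_def intro!: continuous_intros\<close>)+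
  have hol: "holomorphic_into A (ball 0 R) X f"
    unfolding holomorphic_into_def
  proof (intro conjI ballI contf)
    show "f ` ball 0 R \<subseteq> X" using f by auto
    fix d assume dA: "d \<in> A"
    obtain U \<phi> where d: "d = (U, \<phi>)" by (cases d)
    let ?Z = "{z \<in> ball 0 R. f z \<in> U}"
    have "(transition c d \<circ> g) holomorphic_on ?Z"
    proof (rule holomorphic_on_compose_gen[OF _ transition_holomorphic[OF c dA]])
      show "g holomorphic_on ?Z" unfolding g_def by (intro holomorphic_intros)
      show "g ` ?Z \<subseteq> snd c ` (fst c \<inter> fst d)"
      proof clarify
        fix z assume "z \<in> ball 0 R" "f z \<in> U"
        then show "g z \<in> snd c ` (fst c \<inter> fst d)"
          using f[of z] by (intro image_eqI[of _ _ "f z"]) (auto simp: d)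
      qed
    qed
    moreover have "(\<phi> \<circ> f) = (transition c d \<circ> g)" by (auto simp: transition_def f_def d)
    ultimately show "case d of (U, \<phi>) \<Rightarrow> (\<phi> \<circ> f) holomorphic_on {z \<in> ball 0 R. f z \<in> U}"
      by (simp add: d)
  qed
  have vel: "holomorphic_velocity A f 0 = tvec_of_coord A x c v"
  proof
    fix d
    show "holomorphic_velocity A f 0 d = tvec_of_coord A x c v d"
    proof (cases "d \<in> A \<and> x \<in> fst d")
      case False
      then show ?thesis by (auto simp: holomorphic_velocity_def tvec_of_coord_def f0)
    next
      case True
      have "(transition c d has_field_derivative deriv (transition c d) (snd c x)) (at (g 0))"
        using transition_has_deriv[of c d x] True c x by (simp add: g_def)
      moreover have "(g has_field_derivative v) (at 0)"
        unfolding g_def by (auto intro!: derivative_eq_intros)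
      ultimately have "((transition c d \<circ> g) has_field_derivative deriv (transition c d) (snd c x) * v) (at 0)"
        by (rule DERIV_chain)
      moreover have "(snd d \<circ> f) = (transition c d \<circ> g)" by (auto simp: transition_def f_def)
      ultimately show ?thesis
        using True by (auto simp: holomorphic_velocity_def tvec_of_coord_def f0 intro: DERIV_imp_deriv)
    qed
  qed
  have "kobayashi_royden A X x (tvec_of_coord A x c v) \<le> ennreal (2 / R)"
    unfolding kobayashi_royden_def using R hol f0 vel by (intro INF_lower) auto
  then show ?thesis by (simp add: R_def)
qed

text \<open>Only the functions \<open>z \<mapsto> \<rho>(a, b)\<close> for fixed coordinate vectors \<open>a, b\<close> are known to be continuous.
Uniformity in \<open>v\<close> comes from real bilinearity: the three coefficients in the basis \<open>1, \<i>\<close> suffice.\<close>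

lemma riemannian_norm_le:
  assumes \<rho>: "riemannian_metric A \<rho>" and c: "c \<in> A" and K: "compact K" "K \<subseteq> snd c ` fst c"
  shows "\<exists>L\<ge>0. \<forall>z\<in>K. \<forall>v. sqrt (\<rho> (inv_chart c z) (tvec_of_coord A (inv_chart c z) c v)
             (tvec_of_coord A (inv_chart c z) c v)) \<le> L * norm v"
proof -
  let ?e = "\<lambda>z. tvec_of_coord A (inv_chart c z) c"
  define g where "g a b z = \<rho> (inv_chart c z) (?e z a) (?e z b)" for a b z
  have "smooth_on (snd c ` fst c) (g a b)" for a b
    using \<rho> c unfolding riemannian_metric_def g_def Let_def case_prod_unfold
    by (elim conjE) (drule (1) bspec, simp)
  then have "continuous_on (snd c ` fst c) (g a b)" for a b
    unfolding smooth_on_def by (metis Ck_on.simps(1))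
  then have contg: "continuous_on K (g a b)" for a b
    using continuous_on_subset[OF _ K(2)] by blast
  have "\<exists>M. \<forall>z\<in>K. \<bar>g a b z\<bar> \<le> M" for a b
    using compact_imp_bounded[OF compact_continuous_image[OF contg K(1)]]
    by (auto simp: bounded_iff)
  then obtain M where M: "\<And>a b z. z \<in> K \<Longrightarrow> \<bar>g a b z\<bar> \<le> M a b" by metis
  define L where "L = \<bar>M 1 1\<bar> + 2 * \<bar>M 1 \<i>\<bar> + \<bar>M \<i> \<i>\<bar>"
  have "sqrt (g v v z) \<le> sqrt L * norm v" if z: "z \<in> K" for z v
  proof -
    let ?x = "inv_chart c z"
    have x: "?x \<in> fst c" using z K inv_chart_in by blast
    have T: "?e z u \<in> tangent_space A ?x" for u
      using tvec_of_coord_in_tangent_space c x by blast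
    have add: "\<rho> ?x (\<lambda>c. p c + q c) w = \<rho> ?x p w + \<rho> ?x q w"
      and sc: "\<rho> ?x (\<lambda>c. complex_of_real r * p c) w = r * \<rho> ?x p w"
      and sym: "\<rho> ?x p q = \<rho> ?x q p"
      if "p \<in> tangent_space A ?x" "q \<in> tangent_space A ?x" "w \<in> tangent_space A ?x" for p q w r
      using \<rho> that unfolding riemannian_metric_def by blast+
    have lin: "\<rho> ?x (?e z u) w = Re u * \<rho> ?x (?e z 1) w + Im u * \<rho> ?x (?e z \<i>) w"
      if w: "w \<in> tangent_space A ?x" for u w
    proof -
      have "?e z u = (\<lambda>d. ?e z (of_real (Re u)) d + ?e z (\<i> * of_real (Im u)) d)"
        using complex_eq[of u] by (auto simp: tvec_of_coord_def fun_eq_iff distrib_left[symmetric])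
      then have "\<rho> ?x (?e z u) w = \<rho> ?x (?e z (of_real (Re u))) w + \<rho> ?x (?e z (\<i> * of_real (Im u))) w"
        using add[OF T T w] by presburger
      moreover have "?e z (of_real (Re u)) = (\<lambda>d. of_real (Re u) * ?e z 1 d)"
        "?e z (\<i> * of_real (Im u)) = (\<lambda>d. of_real (Im u) * ?e z \<i> d)"
        by (auto simp: tvec_of_coord_def fun_eq_iff)
      ultimately show ?thesis using sc[OF T T w] by presburger
    qed
    have "g v v z = Re v * \<rho> ?x (?e z v) (?e z 1) + Im v * \<rho> ?x (?e z v) (?e z \<i>)"
      unfolding g_def using lin[OF T] sym[OF T T T] by metis
    also have "\<dots> = Re v * (Re v * g 1 1 z + Im v * g \<i> 1 z) + Im v * (Re v * g 1 \<i> z + Im v * g \<i> \<i> z)"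
      unfolding g_def using lin[OF T] by metis
    also have "g \<i> 1 z = g 1 \<i> z" unfolding g_def using sym[OF T T T] by metis
    finally have gv: "g v v z = (Re v)\<^sup>2 * g 1 1 z + 2 * (Re v * Im v) * g 1 \<i> z + (Im v)\<^sup>2 * g \<i> \<i> z"
      by (simp add: algebra_simps power2_eq_square)
    have n: "(norm v)\<^sup>2 = (Re v)\<^sup>2 + (Im v)\<^sup>2" by (rule cmod_power2)
    have rr: "\<bar>Re v * Im v\<bar> \<le> (norm v)\<^sup>2"
      using abs_Re_le_cmod[of v] abs_Im_le_cmod[of v]
      by (simp add: abs_mult power2_eq_square mult_mono)
    have b: "p * q \<le> (norm v)\<^sup>2 * \<bar>m\<bar>" if "\<bar>p\<bar> \<le> (norm v)\<^sup>2" "\<bar>q\<bar> \<le> m" for p q m :: real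
    proof -
      have "p * q \<le> \<bar>p\<bar> * \<bar>q\<bar>" by (metis abs_mult abs_ge_self)
      also have "\<dots> \<le> (norm v)\<^sup>2 * \<bar>m\<bar>" using that by (intro mult_mono) auto
      finally show ?thesis .
    qed
    have "g v v z \<le> (norm v)\<^sup>2 * \<bar>M 1 1\<bar> + 2 * ((norm v)\<^sup>2 * \<bar>M 1 \<i>\<bar>) + (norm v)\<^sup>2 * \<bar>M \<i> \<i>\<bar>"
      using b[of "(Re v)\<^sup>2" "g 1 1 z" "M 1 1"] b[of "(Im v)\<^sup>2" "g \<i> \<i> z" "M \<i> \<i>"]
        b[of "Re v * Im v" "g 1 \<i> z" "M 1 \<i>"] M[OF z] n rr unfolding gv by simp
    then have "g v v z \<le> L * (norm v)\<^sup>2" by (simp add: L_def algebra_simps)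
    then have "sqrt (g v v z) \<le> sqrt (L * (norm v)\<^sup>2)" by (rule real_sqrt_le_mono)
    then show ?thesis by (simp add: real_sqrt_mult)
  qed
  then show ?thesis unfolding g_def by (intro exI[of _ "sqrt L"]) (auto simp: L_def)
qed

end

section \<open>Free homotopies, base points and piecewise smooth curves\<close>

text \<open>In the convex unit square one side is homotopic to the path along the three others; \<open>H\<close> maps this
homotopy into \<open>X\<close>.\<close>

lemma homotopic_paths_square:
  fixes H :: "real \<times> real \<Rightarrow> 'a::topological_space"
  assumes H: "continuous_on ({0..1} \<times> {0..1}) H" "H ` ({0..1} \<times> {0..1}) \<subseteq> X"
  shows "homotopic_paths X (\<lambda>t. H (0, t))
    ((\<lambda>s. H (s, 0)) +++ (\<lambda>t. H (1, t)) +++ reversepath (\<lambda>s. H (s, 1)))"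
proof -
  let ?Q = "{0..1} \<times> {0..1} :: (real \<times> real) set"
  let ?p = "\<lambda>t. (0, t) :: real \<times> real"
  let ?q = "(\<lambda>s. (s, 0) :: real \<times> real) +++ (\<lambda>t. (1, t)) +++ reversepath (\<lambda>s. (s, 1))"
  have sides: "path (\<lambda>s. (s, y) :: real \<times> real)" "path (Pair x :: real \<Rightarrow> real \<times> real)" for x y
    by (auto simp: path_def intro!: continuous_intros)
  then have p: "path ?p" "path ?q"
    by (auto intro!: path_join_imp path_reversepath[THEN iffD2])
       (auto simp: pathstart_def pathfinish_def reversepath_def joinpaths_def)
  have im: "?p t \<in> ?Q" "?q t \<in> ?Q" if "t \<in> {0..1}" for t
    using that by (auto simp: joinpaths_def reversepath_def)
  have "homotopic_paths ?Q ?p ?q"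
  proof (rule homotopic_paths_linear[OF p])
    show "closed_segment (?p t) (?q t) \<subseteq> ?Q" if "t \<in> {0..1}" for t
      using im[OF that] by (intro closed_segment_subset convex_Times) auto
  qed (auto simp: pathstart_def pathfinish_def joinpaths_def reversepath_def)
  from homotopic_paths_continuous_image[OF this H(1)] H(2)
  have "homotopic_paths X (H \<circ> ?p) (H \<circ> ?q)" by auto
  moreover have "H \<circ> ?q = (\<lambda>s. H (s, 0)) +++ (\<lambda>t. H (1, t)) +++ reversepath (\<lambda>s. H (s, 1))"
    by (auto simp: joinpaths_def reversepath_def fun_eq_iff)
  ultimately show ?thesis by (simp add: o_def)
qed

lemma homotopic_paths_conjugate_square:
  fixes H :: "real \<times> real \<Rightarrow> 'a::topological_space"
  assumes H: "continuous_on ({0..1} \<times> {0..1}) H" "H ` ({0..1} \<times> {0..1}) \<subseteq> X"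
    and p: "\<And>t. t \<in> {0..1} \<Longrightarrow> H (0, t) = p t" and q: "\<And>t. t \<in> {0..1} \<Longrightarrow> H (1, t) = q t"
    and \<sigma>: "\<And>s. s \<in> {0..1} \<Longrightarrow> H (s, 0) = \<sigma> s" "\<And>s. s \<in> {0..1} \<Longrightarrow> H (s, 1) = \<sigma> s"
  shows "homotopic_paths X p (\<sigma> +++ q +++ reversepath \<sigma>)"
proof -
  note sq = homotopic_paths_square[OF H]
  have "homotopic_paths X p (\<lambda>t. H (0, t))"
    using homotopic_paths_imp_path[OF sq] homotopic_paths_imp_subset[OF sq] p
    by (subst homotopic_paths_sym_eq, intro homotopic_paths_eq) auto
  moreover have "homotopic_paths X ((\<lambda>s. H (s, 0)) +++ (\<lambda>t. H (1, t)) +++ reversepath (\<lambda>s. H (s, 1)))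
      (\<sigma> +++ q +++ reversepath \<sigma>)"
    using homotopic_paths_imp_path[OF sq] homotopic_paths_imp_subset[OF sq] q \<sigma>
    by (intro homotopic_paths_eq) (auto simp: joinpaths_def reversepath_def)
  ultimately show ?thesis using sq homotopic_paths_trans by metis
qed

lemma loop_class_eq:
  assumes "homotopic_paths X p q"
  shows "loop_class X p = loop_class X q"
  using assms unfolding loop_class_def
  by (auto intro: homotopic_paths_trans simp: homotopic_paths_sym_eq)

text \<open>The predicate \<open>pw_C1_path\<close> on an arbitrary interval, so that curves can be assembled from pieces.\<close>

definition pw_C1_on :: "('a::t2_space) atlas \<Rightarrow> real \<Rightarrow> real \<Rightarrow> (real \<Rightarrow> 'a) \<Rightarrow> bool" where
  "pw_C1_on A u v \<gamma> \<longleftrightarrow>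
     (\<exists>(n::nat) a. a 0 = u \<and> a n = v \<and> (\<forall>i<n. a i < a (Suc i) \<and> C1_curve_on A {a i..a (Suc i)} \<gamma>))"

lemma C1_curve_on_cong:
  assumes "C1_curve_on A I \<gamma>" and eq: "\<And>t. t \<in> I \<Longrightarrow> \<gamma> t = \<gamma>' t"
  shows "C1_curve_on A I \<gamma>'"
  unfolding C1_curve_on_def
proof (intro conjI ballI)
  show "continuous_on I \<gamma>'" using assms by (simp add: C1_curve_on_def cong: continuous_on_cong)
  fix d assume d: "d \<in> A"
  obtain U \<phi> where [simp]: "d = (U, \<phi>)" by (cases d)
  have J: "{t\<in>I. \<gamma>' t \<in> U} = {t\<in>I. \<gamma> t \<in> U}" using eq by auto
  from assms(1) d obtain D where D: "\<And>t. t \<in> {t\<in>I. \<gamma> t \<in> U} \<Longrightarrow>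
      ((\<phi> \<circ> \<gamma>) has_vector_derivative D t) (at t within {t\<in>I. \<gamma> t \<in> U})"
    "continuous_on {t\<in>I. \<gamma> t \<in> U} D"
    unfolding C1_curve_on_def C1_within_def by fastforce
  have "((\<phi> \<circ> \<gamma>') has_vector_derivative D t) (at t within {t\<in>I. \<gamma> t \<in> U})"
    if "t \<in> {t\<in>I. \<gamma> t \<in> U}" for t
    by (rule has_vector_derivative_transform[OF that _ D(1)[OF that]]) (use eq in auto)
  then show "case d of (U, \<phi>) \<Rightarrow> C1_within {t\<in>I. \<gamma>' t \<in> U} (\<phi> \<circ> \<gamma>')"
    using D(2) J by (auto simp: C1_within_def)
qed

lemma partition_bounds:
  fixes a :: "nat \<Rightarrow> real"
  assumes "\<And>i. i < n \<Longrightarrow> a i < a (Suc i)" and "i < n"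
  shows "{a i..a (Suc i)} \<subseteq> {a 0..a n}"
proof -
  have mono: "a i \<le> a j" if "i \<le> j" "j \<le> n" for i j
    using that
  proof (induction j rule: dec_induct)
    case (step k)
    then show ?case using assms(1)[of k] by auto
  qed simp
  show ?thesis using mono[of 0 i] mono[of "Suc i" n] assms(2) by auto
qed

lemma pw_C1_on_cong:
  assumes "pw_C1_on A u v \<gamma>" and eq: "\<And>t. t \<in> {u..v} \<Longrightarrow> \<gamma> t = \<gamma>' t"
  shows "pw_C1_on A u v \<gamma>'"
proof -
  from assms(1) obtain n :: nat and a where a: "a 0 = u" "a n = v"
    "\<And>i. i < n \<Longrightarrow> a i < a (Suc i)" "\<And>i. i < n \<Longrightarrow> C1_curve_on A {a i..a (Suc i)} \<gamma>"
    unfolding pw_C1_on_def by auto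
  have "C1_curve_on A {a i..a (Suc i)} \<gamma>'" if "i < n" for i
    using a(4)[OF that] partition_bounds[of n a i] that a eq by (elim C1_curve_on_cong) auto
  then show ?thesis using a unfolding pw_C1_on_def by blast
qed

lemma pw_C1_on_join:
  assumes "pw_C1_on A u v \<gamma>" "pw_C1_on A v w \<gamma>"
  shows "pw_C1_on A u w \<gamma>"
proof -
  from assms(1) obtain n :: nat and a where a: "a 0 = u" "a n = v"
    "\<And>i. i < n \<Longrightarrow> a i < a (Suc i) \<and> C1_curve_on A {a i..a (Suc i)} \<gamma>"
    unfolding pw_C1_on_def by auto
  from assms(2) obtain n' :: nat and a' where a': "a' 0 = v" "a' n' = w"
    "\<And>i. i < n' \<Longrightarrow> a' i < a' (Suc i) \<and> C1_curve_on A {a' i..a' (Suc i)} \<gamma>"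
    unfolding pw_C1_on_def by auto
  define c where "c i = (if i \<le> n then a i else a' (i - n))" for i
  have c': "c i = a' (i - n)" if "i \<ge> n" for i using that a a' by (cases "i = n") (auto simp: c_def)
  have "c i < c (Suc i) \<and> C1_curve_on A {c i..c (Suc i)} \<gamma>" if "i < n + n'" for i
  proof (cases "i < n")
    case True
    then show ?thesis using a(3)[of i] by (simp add: c_def)
  next
    case False
    then show ?thesis using a'(3)[of "i - n"] that by (simp add: c' Suc_diff_le)
  qed
  moreover have "c 0 = u" "c (n + n') = w" using a a' c'[of "n + n'"] by (auto simp: c_def)
  ultimately show ?thesis unfolding pw_C1_on_def by blast
qed

section \<open>Sweeping a path through a one-parameter family\<close>

context riemann_surface begin

definition chart_at :: "'a \<Rightarrow> 'a chart" where
  "chart_at x = (SOME c. c \<in> A \<and> x \<in> fst c)"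

lemma chart_at: "chart_at x \<in> A" "x \<in> fst (chart_at x)"
  using someI_ex[of "\<lambda>c. c \<in> A \<and> x \<in> fst c"] chart_exists[of x] unfolding chart_at_def by blast+

text \<open>The chart is a function of \<open>x\<close> alone. This makes the motions of two path pieces that meet in \<open>x\<close>
agree there, and gives all loops at \<open>b\<^sub>0\<close> the same moved base point.\<close>

definition nudge :: "'a \<Rightarrow> complex \<Rightarrow> 'a" where
  "nudge x w = inv_chart (chart_at x) (snd (chart_at x) x + w)"

lemma nudge_zero: "nudge x 0 = x"
  using chart_at[of x] by (simp add: nudge_def)

text \<open>Seen in another chart, \<open>nudge x\<close> is a transition map composed with a translation.\<close>

lemma nudge_in_chart:
  assumes c: "c \<in> A" and x: "x \<in> fst c"
  shows "\<exists>R>0. (\<lambda>w. snd c (nudge x w)) holomorphic_on ball 0 R \<and>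
    deriv (\<lambda>w. snd c (nudge x w)) 0 \<noteq> 0 \<and> (\<forall>w\<in>ball 0 R. nudge x w \<in> fst c)"
proof -
  let ?d = "chart_at x"
  note d = chart_at[of x]
  let ?W = "snd ?d ` (fst ?d \<inter> fst c)"
  have "open ?W" using d c by (intro open_transition_domain)
  moreover have "snd ?d x \<in> ?W" using d x by auto
  ultimately obtain R where R: "R > 0" "ball (snd ?d x) R \<subseteq> ?W" by (meson openE)
  define g where "g w = snd ?d x + w" for w
  have g: "g w \<in> ?W" if "w \<in> ball 0 R" for w
    using that R by (auto simp: g_def dist_norm subset_iff)
  have eq: "(\<lambda>w. snd c (nudge x w)) = transition ?d c \<circ> g"
    by (auto simp: nudge_def g_def transition_def)
  have hol: "(\<lambda>w. snd c (nudge x w)) holomorphic_on ball 0 R"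
    unfolding eq
  proof (rule holomorphic_on_compose_gen[OF _ transition_holomorphic[OF d(1) c]])
    show "g holomorphic_on ball 0 R"
      unfolding g_def by (intro holomorphic_intros)
  qed (use g in blast)
  have "(transition ?d c has_field_derivative deriv (transition ?d c) (snd ?d x)) (at (g 0))"
    using transition_has_deriv[OF d(1) c d(2) x] by (simp add: g_def)
  moreover have "(g has_field_derivative 1) (at 0)"
    unfolding g_def by (auto intro!: derivative_eq_intros)
  ultimately have "(transition ?d c \<circ> g has_field_derivative deriv (transition ?d c) (snd ?d x) * 1) (at 0)"
    by (rule DERIV_chain)
  then have "deriv (\<lambda>w. snd c (nudge x w)) 0 \<noteq> 0"
    unfolding eq using deriv_transition_nonzero[OF d(1) c d(2) x] by (simp add: DERIV_imp_deriv)
  moreover have "nudge x w \<in> fst c" if "w \<in> ball 0 R" for w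
    using g[OF that] d by (auto simp: nudge_def g_def)
  ultimately show ?thesis using R(1) hol by (intro exI[of _ R]) simp
qed

text \<open>\<open>\<Gamma>\<close> moves the piece of \<open>P\<close> over \<open>{a..b}\<close>, with uniform data \<open>K\<close>, \<open>L\<close>, \<open>C\<close>. For a finite set \<open>S\<close> the
function \<open>M\<close> bounds the Kobayashi lengths of the curves and has an integral of order \<open>sqrt (card S)\<close>;
being finite at \<open>w\<close>, it certifies that the curve of \<open>w\<close> misses \<open>S\<close>. The length bounds are
stated for every \<open>\<gamma>\<close> that agrees with \<open>\<Gamma> w\<close> on \<open>{a..b}\<close>, because \<open>velocity\<close> refers to a curve on all
of \<open>{0..1}\<close> and the pieces of a path are known only on their own intervals.\<close>

definition sweep ::
    "'a set \<Rightarrow> ('a \<Rightarrow> 'a tvec \<Rightarrow> 'a tvec \<Rightarrow> real) \<Rightarrow> (real \<Rightarrow> 'a) \<Rightarrow> real \<Rightarrow> real \<Rightarrow>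
     real \<Rightarrow> real \<Rightarrow> real \<Rightarrow> 'a set \<Rightarrow> (complex \<Rightarrow> real \<Rightarrow> 'a) \<Rightarrow> bool" where
  "sweep B \<rho> P a b r C L K \<Gamma> \<longleftrightarrow>
     compact K \<and> K \<subseteq> B \<and> C \<ge> 0 \<and> L \<ge> 0 \<and>
     (\<forall>w\<in>cball 0 r. \<Gamma> w a = nudge (P a) w \<and> \<Gamma> w b = nudge (P b) w) \<and>
     (\<forall>t\<in>{a..b}. \<Gamma> 0 t = P t) \<and>
     continuous_on (cball 0 r \<times> {a..b}) (\<lambda>(w, t). \<Gamma> w t) \<and>
     (\<forall>w\<in>cball 0 r. pw_C1_on A a b (\<Gamma> w)) \<and>
     (\<forall>w\<in>cball 0 r. \<forall>t\<in>{a..b}. \<Gamma> w t \<in> K) \<and>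
     (\<forall>w\<in>cball 0 r. \<forall>\<gamma>. (\<forall>t\<in>{a..b}. \<gamma> t = \<Gamma> w t) \<longrightarrow>
        (\<integral>\<^sup>+t\<in>{a..b}. ennreal (sqrt (\<rho> (\<gamma> t) (velocity A \<gamma> t) (velocity A \<gamma> t))) \<partial>lborel) \<le> ennreal L) \<and>
     (\<forall>S. finite S \<and> S \<noteq> {} \<longrightarrow> (\<exists>M\<in>borel_measurable borel.
        (\<integral>\<^sup>+w\<in>cball 0 r. M w \<partial>lborel) \<le> ennreal (C * sqrt (card S)) \<and>
        (\<forall>w\<in>cball 0 r. M w < \<infinity> \<longrightarrow> (\<forall>t\<in>{a..b}. \<Gamma> w t \<notin> S) \<and>
           (\<forall>\<gamma>. (\<forall>t\<in>{a..b}. \<gamma> t = \<Gamma> w t) \<longrightarrow>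
             (\<integral>\<^sup>+t\<in>{a..b}. kobayashi_royden A (B - S) (\<gamma> t) (velocity A \<gamma> t) \<partial>lborel) \<le> M w))))"

lemma sweepD:
  assumes "sweep B \<rho> P a b r C L K \<Gamma>"
  shows sweep_compact: "compact K" "K \<subseteq> B" and sweep_nonneg: "C \<ge> 0" "L \<ge> 0"
    and sweep_ends: "\<And>w. w \<in> cball 0 r \<Longrightarrow> \<Gamma> w a = nudge (P a) w" "\<And>w. w \<in> cball 0 r \<Longrightarrow> \<Gamma> w b = nudge (P b) w"
    and sweep_zero: "\<And>t. t \<in> {a..b} \<Longrightarrow> \<Gamma> 0 t = P t"
    and sweep_continuous: "continuous_on (cball 0 r \<times> {a..b}) (\<lambda>(w, t). \<Gamma> w t)"
    and sweep_pw_C1: "\<And>w. w \<in> cball 0 r \<Longrightarrow> pw_C1_on A a b (\<Gamma> w)"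
    and sweep_in: "\<And>w t. w \<in> cball 0 r \<Longrightarrow> t \<in> {a..b} \<Longrightarrow> \<Gamma> w t \<in> K"
    and sweep_length: "\<And>w \<gamma>. w \<in> cball 0 r \<Longrightarrow> \<forall>t\<in>{a..b}. \<gamma> t = \<Gamma> w t \<Longrightarrow>
        (\<integral>\<^sup>+t\<in>{a..b}. ennreal (sqrt (\<rho> (\<gamma> t) (velocity A \<gamma> t) (velocity A \<gamma> t))) \<partial>lborel) \<le> ennreal L"
    and sweep_cost: "\<And>S. finite S \<Longrightarrow> S \<noteq> {} \<Longrightarrow> \<exists>M\<in>borel_measurable borel.
        (\<integral>\<^sup>+w\<in>cball 0 r. M w \<partial>lborel) \<le> ennreal (C * sqrt (card S)) \<and>
        (\<forall>w\<in>cball 0 r. M w < \<infinity> \<longrightarrow> (\<forall>t\<in>{a..b}. \<Gamma> w t \<notin> S) \<and>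
           (\<forall>\<gamma>. (\<forall>t\<in>{a..b}. \<gamma> t = \<Gamma> w t) \<longrightarrow>
             (\<integral>\<^sup>+t\<in>{a..b}. kobayashi_royden A (B - S) (\<gamma> t) (velocity A \<gamma> t) \<partial>lborel) \<le> M w))"
proof -
  note assms = assms[unfolded sweep_def]
  show "compact K" "K \<subseteq> B" "C \<ge> 0" "L \<ge> 0" using assms by simp_all
  show "\<Gamma> w a = nudge (P a) w" "\<Gamma> w b = nudge (P b) w" "pw_C1_on A a b (\<Gamma> w)" if "w \<in> cball 0 r" for w
    using assms that by simp_all
  show "\<Gamma> 0 t = P t" if "t \<in> {a..b}" for t
    using assms that by simp
  show "continuous_on (cball 0 r \<times> {a..b}) (\<lambda>(w, t). \<Gamma> w t)" using assms by simp
  show "\<Gamma> w t \<in> K" if "w \<in> cball 0 r" "t \<in> {a..b}" for w t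
    using assms that by simp
  show "(\<integral>\<^sup>+t\<in>{a..b}. ennreal (sqrt (\<rho> (\<gamma> t) (velocity A \<gamma> t) (velocity A \<gamma> t))) \<partial>lborel) \<le> ennreal L"
    if "w \<in> cball 0 r" "\<forall>t\<in>{a..b}. \<gamma> t = \<Gamma> w t" for w \<gamma>
    using assms that by blast
qed (use assms[unfolded sweep_def] in \<open>elim conjE, blast\<close>)

lemma sweep_shrink:
  assumes s: "sweep B \<rho> P a b r C L K \<Gamma>" and r': "r' \<le> r"
  shows "sweep B \<rho> P a b r' C L K \<Gamma>"
proof -
  have sub: "cball 0 r' \<subseteq> (cball 0 r :: complex set)" using r' by auto
  have M: "(\<integral>\<^sup>+w\<in>cball 0 r'. M w \<partial>lborel) \<le> (\<integral>\<^sup>+w\<in>cball 0 r. M w \<partial>lborel)"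
    for M :: "complex \<Rightarrow> ennreal"
    using sub by (intro nn_integral_mono) (auto simp: indicator_def)
  show ?thesis unfolding sweep_def
  proof (intro conjI allI impI, goal_cases)
    case (11 S)
    from sweep_cost[OF s, of S] 11 obtain M where "M \<in> borel_measurable borel" and
      le: "(\<integral>\<^sup>+w\<in>cball 0 r. M w \<partial>lborel) \<le> ennreal (C * sqrt (card S))" and
      "\<forall>w\<in>cball 0 r. M w < \<infinity> \<longrightarrow> (\<forall>t\<in>{a..b}. \<Gamma> w t \<notin> S) \<and>
           (\<forall>\<gamma>. (\<forall>t\<in>{a..b}. \<gamma> t = \<Gamma> w t) \<longrightarrow>
             (\<integral>\<^sup>+t\<in>{a..b}. kobayashi_royden A (B - S) (\<gamma> t) (velocity A \<gamma> t) \<partial>lborel) \<le> M w)"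
      by blast
    then show ?case using order_trans[OF M le] sub by (intro bexI[of _ M]) blast+
  next
    case 7
    have "continuous_on (cball 0 r \<times> {a..b}) (\<lambda>(w, t). \<Gamma> w t)" by (rule sweep_continuous[OF s])
    then show ?case by (rule continuous_on_subset) (use sub in auto)
  next
    case 5
    show ?case using sweep_ends[OF s] sub by blast
  next
    case 6
    show ?case using sweep_zero[OF s] by blast
  next
    case 8
    show ?case using sweep_pw_C1[OF s] sub by blast
  next
    case 9
    show ?case using sweep_in[OF s] sub by blast
  next
    case 10
    show ?case using sweep_length[OF s] sub by blast
  qed (use sweep_compact[OF s] sweep_nonneg[OF s] in auto)
qed

lemma sweep_join:
  assumes s1: "sweep B \<rho> P a b r C1 L1 K1 \<Gamma>1" and s2: "sweep B \<rho> P b c r C2 L2 K2 \<Gamma>2"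
    and abc: "a \<le> b" "b \<le> c"
  shows "sweep B \<rho> P a c r (C1 + C2) (L1 + L2) (K1 \<union> K2) (\<lambda>w t. if t \<le> b then \<Gamma>1 w t else \<Gamma>2 w t)"
proof -
  define \<Gamma> where "\<Gamma> w t = (if t \<le> b then \<Gamma>1 w t else \<Gamma>2 w t)" for w t
  have un: "{a..c} = {a..b} \<union> {b..c}" using abc by auto
  have CL: "C1 \<ge> 0" "L1 \<ge> 0" "C2 \<ge> 0" "L2 \<ge> 0" using sweep_nonneg[OF s1] sweep_nonneg[OF s2] by auto
  have at_b: "\<Gamma>1 w b = \<Gamma>2 w b" if "w \<in> cball 0 r" for w
    using sweep_ends(2)[OF s1 that] sweep_ends(1)[OF s2 that] by simp
  have \<Gamma>1: "\<Gamma> w t = \<Gamma>1 w t" if "t \<in> {a..b}" for w t using that by (simp add: \<Gamma>_def)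
  have \<Gamma>2: "\<Gamma> w t = \<Gamma>2 w t" if "w \<in> cball 0 r" "t \<in> {b..c}" for w t
    using that at_b by (cases "t = b") (auto simp: \<Gamma>_def)
  have "sweep B \<rho> P a c r (C1 + C2) (L1 + L2) (K1 \<union> K2) \<Gamma>"
    unfolding sweep_def
  proof (intro conjI allI impI ballI, goal_cases)
    case 1
    show ?case using sweep_compact[OF s1] sweep_compact[OF s2] by (intro compact_Un)
  next
    case 2
    show ?case using sweep_compact[OF s1] sweep_compact[OF s2] by simp
  next
    case 3
    show ?case using CL by simp
  next
    case 4
    show ?case using CL by simp
  next
    case (5 w)
    then show ?case using sweep_ends[OF s1] \<Gamma>1[of a w] abc by simp
  next
    case (6 w)
    then show ?case using sweep_ends[OF s2] \<Gamma>2[of w c] abc by simp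
  next
    case (7 t)
    show ?case
    proof (cases "t \<le> b")
      case True
      then show ?thesis using sweep_zero[OF s1] 7 by (simp add: \<Gamma>_def)
    next
      case False
      then show ?thesis using sweep_zero[OF s2] 7 by (simp add: \<Gamma>_def)
    qed
  next
    case 8
    have c1: "continuous_on (cball 0 r \<times> {a..b}) (\<lambda>(w, t). \<Gamma> w t)"
    proof -
      have "continuous_on (cball 0 r \<times> {a..b}) (\<lambda>(w, t). \<Gamma>1 w t)" by (rule sweep_continuous[OF s1])
      then show ?thesis by (rule continuous_on_eq) (use \<Gamma>1 in auto)
    qed
    have c2: "continuous_on (cball 0 r \<times> {b..c}) (\<lambda>(w, t). \<Gamma> w t)"
    proof -
      have "continuous_on (cball 0 r \<times> {b..c}) (\<lambda>(w, t). \<Gamma>2 w t)" by (rule sweep_continuous[OF s2])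
      then show ?thesis by (rule continuous_on_eq) (use \<Gamma>2 in auto)
    qed
    have "cball 0 r \<times> {a..c} = cball 0 r \<times> {a..b} \<union> cball (0::complex) r \<times> {b..c}" using un by auto
    then show ?case using continuous_on_closed_Un[OF _ _ c1 c2] by (simp add: closed_Times)
  next
    case (9 w)
    have "pw_C1_on A a b (\<Gamma>1 w)" "pw_C1_on A b c (\<Gamma>2 w)" using sweep_pw_C1[OF s1 9] sweep_pw_C1[OF s2 9] .
    then have "pw_C1_on A a b (\<Gamma> w)" "pw_C1_on A b c (\<Gamma> w)"
      by (auto elim!: pw_C1_on_cong simp: \<Gamma>1 \<Gamma>2[OF 9])
    then show ?case by (rule pw_C1_on_join)
  next
    case (10 w t)
    then show ?case using sweep_in[OF s1, of w t] sweep_in[OF s2, of w t] by (cases "t \<le> b") (auto simp: \<Gamma>_def)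
  next
    case (11 w \<gamma>)
    let ?f = "\<lambda>t. ennreal (sqrt (\<rho> (\<gamma> t) (velocity A \<gamma> t) (velocity A \<gamma> t)))"
    have "\<forall>t\<in>{a..b}. \<gamma> t = \<Gamma>1 w t" using 11 \<Gamma>1 un by auto
    then have "(\<integral>\<^sup>+t\<in>{a..b}. ?f t \<partial>lborel) \<le> ennreal L1"
      by (rule sweep_length[OF s1 11(1)])
    moreover have "\<forall>t\<in>{b..c}. \<gamma> t = \<Gamma>2 w t" using 11 \<Gamma>2 un by auto
    then have "(\<integral>\<^sup>+t\<in>{b..c}. ?f t \<partial>lborel) \<le> ennreal L2"
      by (rule sweep_length[OF s2 11(1)])
    moreover have "(\<integral>\<^sup>+t\<in>{a..c}. ?f t \<partial>lborel) \<le> (\<integral>\<^sup>+t\<in>{a..b}. ?f t \<partial>lborel) + (\<integral>\<^sup>+t\<in>{b..c}. ?f t \<partial>lborel)"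
      unfolding un by (rule nn_integral_Un_le) auto
    ultimately show ?case using CL by (simp add: order_trans[OF _ add_mono])
  next
    case (12 S)
    from sweep_cost[OF s1, of S] 12 obtain M1 where M1: "M1 \<in> borel_measurable borel" 
      "(\<integral>\<^sup>+w\<in>cball 0 r. M1 w \<partial>lborel) \<le> ennreal (C1 * sqrt (card S))"
      "\<And>w. w\<in>cball 0 r \<Longrightarrow> M1 w < \<infinity> \<Longrightarrow> (\<forall>t\<in>{a..b}. \<Gamma>1 w t \<notin> S)"
      "\<And>w \<gamma>. w\<in>cball 0 r \<Longrightarrow> M1 w < \<infinity> \<Longrightarrow> (\<forall>t\<in>{a..b}. \<gamma> t = \<Gamma>1 w t) \<Longrightarrow>
             (\<integral>\<^sup>+t\<in>{a..b}. kobayashi_royden A (B - S) (\<gamma> t) (velocity A \<gamma> t) \<partial>lborel) \<le> M1 w"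
      by blast
    from sweep_cost[OF s2, of S] 12 obtain M2 where M2: "M2 \<in> borel_measurable borel" 
      "(\<integral>\<^sup>+w\<in>cball 0 r. M2 w \<partial>lborel) \<le> ennreal (C2 * sqrt (card S))"
      "\<And>w. w\<in>cball 0 r \<Longrightarrow> M2 w < \<infinity> \<Longrightarrow> (\<forall>t\<in>{b..c}. \<Gamma>2 w t \<notin> S)"
      "\<And>w \<gamma>. w\<in>cball 0 r \<Longrightarrow> M2 w < \<infinity> \<Longrightarrow> (\<forall>t\<in>{b..c}. \<gamma> t = \<Gamma>2 w t) \<Longrightarrow>
             (\<integral>\<^sup>+t\<in>{b..c}. kobayashi_royden A (B - S) (\<gamma> t) (velocity A \<gamma> t) \<partial>lborel) \<le> M2 w"
      by blast
    note [measurable] = M1(1) M2(1)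
    have [measurable]: "cball 0 r \<in> sets (borel :: complex measure)" by simp
    show ?case
    proof (intro bexI[of _ "\<lambda>w. M1 w + M2 w"] conjI ballI impI allI)
      show "(\<lambda>w. M1 w + M2 w) \<in> borel_measurable borel" by measurable
      have "(\<integral>\<^sup>+w\<in>cball 0 r. (M1 w + M2 w) \<partial>lborel)
          = (\<integral>\<^sup>+w\<in>cball 0 r. M1 w \<partial>lborel) + (\<integral>\<^sup>+w\<in>cball 0 r. M2 w \<partial>lborel)"
        unfolding distrib_right by (rule nn_integral_add) auto
      also have "\<dots> \<le> ennreal (C1 * sqrt (card S)) + ennreal (C2 * sqrt (card S))"
        by (intro add_mono M1 M2)
      also have "\<dots> = ennreal ((C1 + C2) * sqrt (card S))"
        using CL by (simp add: ennreal_plus[symmetric] distrib_right del: ennreal_plus)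
      finally show "(\<integral>\<^sup>+w\<in>cball 0 r. (M1 w + M2 w) \<partial>lborel) \<le> ennreal ((C1 + C2) * sqrt (card S))" .
    next
      fix w assume w: "w \<in> cball 0 r" and "M1 w + M2 w < \<infinity>"
      then have fin: "M1 w < \<infinity>" "M2 w < \<infinity>" by (auto simp: less_top)
      show "\<Gamma> w t \<notin> S" if "t \<in> {a..c}" for t
        using that M1(3)[OF w fin(1)] M2(3)[OF w fin(2)] by (auto simp: \<Gamma>_def)
      fix \<gamma> assume \<gamma>: "\<forall>t\<in>{a..c}. \<gamma> t = \<Gamma> w t"
      let ?f = "\<lambda>t. kobayashi_royden A (B - S) (\<gamma> t) (velocity A \<gamma> t)"
      have "\<forall>t\<in>{a..b}. \<gamma> t = \<Gamma>1 w t" "\<forall>t\<in>{b..c}. \<gamma> t = \<Gamma>2 w t" using \<gamma> \<Gamma>1 \<Gamma>2[OF w] un by auto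
      from M1(4)[OF w fin(1) this(1)] M2(4)[OF w fin(2) this(2)]
      have "(\<integral>\<^sup>+t\<in>{a..b}. ?f t \<partial>lborel) + (\<integral>\<^sup>+t\<in>{b..c}. ?f t \<partial>lborel) \<le> M1 w + M2 w" by (rule add_mono)
      moreover have "(\<integral>\<^sup>+t\<in>{a..c}. ?f t \<partial>lborel) \<le> (\<integral>\<^sup>+t\<in>{a..b}. ?f t \<partial>lborel) + (\<integral>\<^sup>+t\<in>{b..c}. ?f t \<partial>lborel)"
        unfolding un by (rule nn_integral_Un_le) auto
      ultimately show "(\<integral>\<^sup>+t\<in>{a..c}. ?f t \<partial>lborel) \<le> M1 w + M2 w" by (rule order_trans[rotated])
    qed
  qed
  then show ?thesis by (simp add: \<Gamma>_def[abs_def])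
qed

text \<open>The plane family of \<open>lower_lipschitz_edge_family\<close>, transported by the chart. Its compact image \<open>I\<close> keeps a
distance \<open>\<epsilon>\<close> from the boundary of the chart image \<open>U\<close> of \<open>B\<close>, so the coordinate disk about a point of
\<open>I\<close> whose radius is the smaller of \<open>\<epsilon>\<close> and the distance to \<open>S\<close> lies in \<open>B - S\<close>.\<close>

lemma sweep_exists_in_chart:
  assumes \<rho>: "riemannian_metric A \<rho>" and B: "open B" and ab: "0 \<le> a" "a < b" "b \<le> 1" and c: "c \<in> A"
    and P: "\<And>t. t \<in> {a..b} \<Longrightarrow> P t \<in> fst c \<inter> B"
      "\<And>t. t \<in> {a..b} \<Longrightarrow> ((\<lambda>t. snd c (P t)) has_vector_derivative p' t) (at t within {a..b})"
      "continuous_on {a..b} p'"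
  shows "\<exists>r>0. \<exists>C L K \<Gamma>. sweep B \<rho> P a b r C L K \<Gamma>"
proof -
  let ?Q = "\<lambda>x w. snd c (nudge x w)"
  define U where "U = snd c ` (fst c \<inter> B)"
  have U: "open U" "U \<subseteq> snd c ` fst c" using open_chart_subimage[OF c B] by (auto simp: U_def)
  have Pa: "P a \<in> fst c" and Pb: "P b \<in> fst c" using P(1)[of a] P(1)[of b] ab by auto
  obtain R0 where R0: "R0 > 0" "?Q (P a) holomorphic_on ball 0 R0" "deriv (?Q (P a)) 0 \<noteq> 0"
    "\<And>w. w \<in> ball 0 R0 \<Longrightarrow> nudge (P a) w \<in> fst c"
    using nudge_in_chart[OF c Pa] by blast
  obtain R1 where R1: "R1 > 0" "?Q (P b) holomorphic_on ball 0 R1" "deriv (?Q (P b)) 0 \<noteq> 0"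
    "\<And>w. w \<in> ball 0 R1 \<Longrightarrow> nudge (P b) w \<in> fst c"
    using nudge_in_chart[OF c Pb] by blast
  define R where "R = min R0 R1"
  have R: "R > 0" "ball 0 R \<subseteq> (ball 0 R0 :: complex set)" "ball 0 R \<subseteq> (ball 0 R1 :: complex set)"
    using R0 R1 by (auto simp: R_def)
  have at_0: "?Q x 0 = snd c x" for x by (simp add: nudge_zero)
  have PU: "(\<lambda>t. snd c (P t)) ` {a..b} \<subseteq> U" using P(1) by (auto simp: U_def)
  obtain r m X X' where r: "r > 0" "r < R" and m: "m > 0"
    and XU: "\<And>t w. t \<in> {a..b} \<Longrightarrow> w \<in> cball 0 r \<Longrightarrow> X t w \<in> U"
    and Xa: "\<And>w. w \<in> cball 0 r \<Longrightarrow> X a w = ?Q (P a) w"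
    and Xb: "\<And>w. w \<in> cball 0 r \<Longrightarrow> X b w = ?Q (P b) w"
    and X0: "\<And>t. t \<in> {a..b} \<Longrightarrow> X t 0 = snd c (P t)"
    and contX: "continuous_on ({a..b} \<times> cball 0 r) (\<lambda>(t, w). X t w)"
    and contX': "continuous_on ({a..b} \<times> cball 0 r) (\<lambda>(t, w). X' t w)"
    and dX: "\<And>t w. t \<in> {a..b} \<Longrightarrow> w \<in> cball 0 r \<Longrightarrow> ((\<lambda>t. X t w) has_vector_derivative X' t w) (at t within {a..b})"
    and expand: "\<And>t w w'. t \<in> {a..b} \<Longrightarrow> w \<in> cball 0 r \<Longrightarrow> w' \<in> cball 0 r \<Longrightarrow> m * dist w w' \<le> dist (X t w) (X t w')"
    using lower_lipschitz_edge_family[OF ab(2) R(1) P(2,3) U(1) PU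
        holomorphic_on_subset[OF R0(2) R(2)] R0(3) at_0 holomorphic_on_subset[OF R1(2) R(3)] R1(3) at_0]
    by blast
  define I where "I = (\<lambda>(t, w). X t w) ` ({a..b} \<times> cball 0 r)"
  have I: "compact I" "I \<subseteq> U" "I \<noteq> {}"
    unfolding I_def using contX XU ab r by (auto intro!: compact_continuous_image compact_Times)
  have XI: "X t w \<in> I" if "t \<in> {a..b}" "w \<in> cball 0 r" for t w using that by (auto simp: I_def)
  obtain \<epsilon> where \<epsilon>: "\<epsilon> > 0" "{x. infdist x I \<le> \<epsilon>} \<subseteq> U"
    using compact_in_open_separated[OF I(3,1) U(1) I(2)] by blast
  have \<epsilon>U: "ball x \<epsilon> \<subseteq> U" if "x \<in> I" for x
  proof
    fix y assume "y \<in> ball x \<epsilon>"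
    then have "infdist y I \<le> \<epsilon>" using infdist_le[OF that, of y] by (auto simp: dist_commute)
    then show "y \<in> U" using \<epsilon> by auto
  qed
  obtain V where V: "V > 0" "\<And>p. p \<in> {a..b} \<times> cball 0 r \<Longrightarrow> norm ((\<lambda>(t, w). X' t w) p) \<le> V"
    using compact_image_bound[OF compact_Times[OF compact_Icc compact_cball] contX'] by blast
  have VX': "norm (X' t w) \<le> V" if "t \<in> {a..b}" "w \<in> cball 0 r" for t w using V(2)[of "(t, w)"] that by simp
  obtain L where L: "L \<ge> 0" "\<And>z v. z \<in> I \<Longrightarrow> sqrt (\<rho> (inv_chart c z) (tvec_of_coord A (inv_chart c z) c v)
             (tvec_of_coord A (inv_chart c z) c v)) \<le> L * norm v"
    using riemannian_norm_le[OF \<rho> c I(1)] I(2) U(2) by blast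
  define \<Gamma> where "\<Gamma> w t = inv_chart c (X t w)" for w t
  have \<Gamma>: "\<Gamma> w t \<in> fst c" "\<Gamma> w t \<in> B" "snd c (\<Gamma> w t) = X t w" if "t \<in> {a..b}" "w \<in> cball 0 r" for t w
    using XU[OF that] c by (auto simp: \<Gamma>_def U_def)
  define K where "K = inv_chart c ` I"
  have K: "compact K" "K \<subseteq> B"
  proof -
    show "compact K" unfolding K_def
      using I(2) U(2) by (intro compact_continuous_image continuous_on_subset[OF continuous_on_inv_chart[OF c]] I(1)) auto
    show "K \<subseteq> B" unfolding K_def using I(2) c by (auto simp: U_def)
  qed
  have contXw: "continuous_on {a..b} (\<lambda>t. X t w)" "continuous_on {a..b} (\<lambda>t. X' t w)" if w: "w \<in> cball 0 r" for w
  proof -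
    have tw: "continuous_on {a..b} (\<lambda>t. (t, w))" "(\<lambda>t. (t, w)) ` {a..b} \<subseteq> {a..b} \<times> cball 0 r"
      using w by (auto intro!: continuous_intros)
    show "continuous_on {a..b} (\<lambda>t. X t w)" "continuous_on {a..b} (\<lambda>t. X' t w)"
      using continuous_on_compose2[OF contX tw] continuous_on_compose2[OF contX' tw] by simp_all
  qed
  have vel: "velocity A \<gamma> t = tvec_of_coord A (\<gamma> t) c (X' t w)"
    if w: "w \<in> cball 0 r" and t: "t \<in> {a<..<b}" and \<gamma>: "\<forall>t\<in>{a..b}. \<gamma> t = \<Gamma> w t" for w t \<gamma>
  proof (rule velocity_eq_tvec_of_coord[OF c ab(1,3) t])
    show "continuous_on {a<..<b} (\<lambda>t. X t w)" using contXw(1)[OF w] by (rule continuous_on_subset) auto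
    show "((\<lambda>t. X t w) has_vector_derivative X' t w) (at t)"
      using dX[of t w] w t by (simp add: at_within_Icc_at)
  qed (use \<gamma> \<Gamma> w in auto)
  define C where "C = 2 * V * (b - a) * ((1 / \<epsilon> + 1) * (pi * r\<^sup>2) + 16 * pi / m\<^sup>2)"
  have "sweep B \<rho> P a b r C (L * V * (b - a)) K \<Gamma>"
    unfolding sweep_def
  proof (intro conjI allI impI ballI, goal_cases)
    case 1
    show ?case by (rule K)
  next
    case 2
    show ?case by (rule K)
  next
    case 3
    show ?case using V \<epsilon> ab by (auto simp: C_def intro!: mult_nonneg_nonneg add_nonneg_nonneg)
  next
    case 4
    show ?case using V L ab by auto
  next
    case (5 w)
    then have "nudge (P a) w \<in> fst c" using r(2) by (intro R0(4) subsetD[OF R(2)]) auto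
    then show ?case using Xa[OF 5] c by (simp add: \<Gamma>_def)
  next
    case (6 w)
    then have "nudge (P b) w \<in> fst c" using r(2) by (intro R1(4) subsetD[OF R(3)]) auto
    then show ?case using Xb[OF 6] c by (simp add: \<Gamma>_def)
  next
    case (7 t)
    then show ?case using X0[OF 7] P(1)[OF 7] c by (simp add: \<Gamma>_def)
  next
    case 8
    have "continuous_on (cball 0 r \<times> {a..b}) (\<lambda>p. (\<lambda>(t, w). X t w) (snd p, fst p))"
      by (rule continuous_on_compose2[OF contX]) (auto intro!: continuous_intros)
    then have cX: "continuous_on (cball 0 r \<times> {a..b}) (\<lambda>p. X (snd p) (fst p))" by simp
    have "continuous_on (cball 0 r \<times> {a..b}) (\<lambda>p. inv_chart c (X (snd p) (fst p)))"
      by (rule continuous_on_compose2[OF continuous_on_inv_chart[OF c] cX]) (use XU U in auto)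
    then show ?case by (simp add: \<Gamma>_def case_prod_unfold)
  next
    case (9 w)
    have "C1_curve_on A {a..b} (\<Gamma> w)"
      using XU U dX contXw 9
      by (intro C1_curve_on_inv_chart[OF c, of _ "\<lambda>t. X t w" "\<lambda>t. X' t w"]) (auto simp: \<Gamma>_def)
    then show ?case using ab unfolding pw_C1_on_def
      by (intro exI[of _ 1] exI[of _ "\<lambda>i. if i = 0 then a else b"]) simp
  next
    case (10 w t)
    then show ?case using XI by (auto simp: K_def \<Gamma>_def)
  next
    case (11 w \<gamma>)
    have "(\<integral>\<^sup>+t\<in>{a..b}. ennreal (sqrt (\<rho> (\<gamma> t) (velocity A \<gamma> t) (velocity A \<gamma> t))) \<partial>lborel)
       \<le> (\<integral>\<^sup>+t\<in>{a..b}. ennreal (L * V) \<partial>lborel)"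
    proof (rule set_nn_integral_mono_open_interval)
      fix t assume t: "t \<in> {a<..<b}"
      then have t': "t \<in> {a..b}" by auto
      have "sqrt (\<rho> (\<gamma> t) (velocity A \<gamma> t) (velocity A \<gamma> t)) \<le> L * norm (X' t w)"
        using L(2)[OF XI[OF t' 11(1)]] 11(2) t' unfolding vel[OF 11(1) t 11(2)] by (simp add: \<Gamma>_def)
      also have "\<dots> \<le> L * V" using VX'[OF t' 11(1)] L by (intro mult_left_mono) auto
      finally show "ennreal (sqrt (\<rho> (\<gamma> t) (velocity A \<gamma> t) (velocity A \<gamma> t))) \<le> ennreal (L * V)"
        by (rule ennreal_leI)
    qed
    also have "\<dots> = ennreal (L * V * (b - a))"
      using L V ab by (subst nn_integral_cmult_indicator) (auto simp: ennreal_mult'')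
    finally show ?case .
  next
    case (12 S)
    define N where "N = sqrt (card S)"
    have cS: "1 \<le> card S" using 12 by (simp add: Suc_leI card_gt_0_iff)
    then have N: "N \<ge> 1" by (simp add: N_def)
    define T where "T = snd c ` (S \<inter> fst c)"
    have T: "finite T" using 12 by (simp add: T_def)
    have "card T \<le> card S" unfolding T_def using 12
      by (meson card_image_le card_mono finite_Int inf_le1 order_trans)
    then have cT: "real (card T) \<le> N\<^sup>2" by (simp add: N_def)
    have lip: "dist (X s w) (X t w) \<le> V * \<bar>t - s\<bar>" if "s \<in> {a..b}" "t \<in> {a..b}" "w \<in> cball 0 r" for s t w
      using has_vector_derivative_imp_lipschitz[of a b "\<lambda>t. X t w" "\<lambda>t. X' t w" V s t] dX VX' that by auto
    obtain M where M: "M \<in> borel_measurable borel"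
      "(\<integral>\<^sup>+w\<in>cball 0 r. M w \<partial>lborel) \<le> ennreal (C * N)"
      "\<And>w. w \<in> cball 0 r \<Longrightarrow> M w = (\<integral>\<^sup>+t\<in>{a..b}. ennreal (2 * V) * (ennreal (1 / \<epsilon>) + inv_dist_majorant N T (X t w)) \<partial>lborel)"
      "\<And>w t. w \<in> cball 0 r \<Longrightarrow> M w < \<infinity> \<Longrightarrow> t \<in> {a..b} \<Longrightarrow> X t w \<notin> T"
      using average_cost_of_family[OF ab(2) r(1) m \<epsilon>(1) V(1) T cT N contX expand lip] unfolding C_def by blast
    show ?case
    proof (intro bexI[OF _ M(1)] conjI ballI impI allI)
      show "(\<integral>\<^sup>+w\<in>cball 0 r. M w \<partial>lborel) \<le> ennreal (C * sqrt (card S))" using M(2) by (simp add: N_def)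
      fix w assume w: "w \<in> cball 0 r" and fin: "M w < \<infinity>"
      show "\<Gamma> w t \<notin> S" if "t \<in> {a..b}" for t
      proof
        assume "\<Gamma> w t \<in> S"
        then have "snd c (\<Gamma> w t) \<in> T" using \<Gamma>(1)[OF that w] by (auto simp: T_def)
        then show False using M(4)[OF w fin that] \<Gamma>(3)[OF that w] by simp
      qed
      fix \<gamma> assume \<gamma>: "\<forall>t\<in>{a..b}. \<gamma> t = \<Gamma> w t"
      show "(\<integral>\<^sup>+t\<in>{a..b}. kobayashi_royden A (B - S) (\<gamma> t) (velocity A \<gamma> t) \<partial>lborel) \<le> M w"
        unfolding M(3)[OF w]
      proof (rule set_nn_integral_mono_open_interval)
        fix t assume t: "t \<in> {a<..<b}"
        then have t': "t \<in> {a..b}" by auto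
        obtain \<delta> where \<delta>: "\<delta> > 0" "\<forall>p\<in>T. \<delta> \<le> dist (X t w) p" "ennreal (1 / \<delta>) \<le> inv_dist_majorant N T (X t w)"
          using inv_dist_majorant_ge[OF T _ M(4)[OF w fin t'], of N] N by auto
        define d where "d = min \<epsilon> \<delta>"
        have d: "d > 0" using \<epsilon> \<delta> by (simp add: d_def)
        have sub: "ball (X t w) d \<subseteq> snd c ` (fst c \<inter> (B - S))"
        proof
          fix y assume y: "y \<in> ball (X t w) d"
          then have "y \<in> U" using \<epsilon>U[OF XI[OF t' w]] by (auto simp: d_def)
          then obtain z where z: "z \<in> fst c" "z \<in> B" "y = snd c z" by (auto simp: U_def)
          have "y \<notin> T" using y \<delta>(2) by (fastforce simp: d_def)
          then have "z \<notin> S" using z by (auto simp: T_def)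
          then show "y \<in> snd c ` (fst c \<inter> (B - S))" using z by auto
        qed
        have "kobayashi_royden A (B - S) (\<gamma> t) (velocity A \<gamma> t) \<le> ennreal (2 * V / d)"
          unfolding vel[OF w t \<gamma>]
          using \<gamma> t' \<Gamma>[OF t' w] VX'[OF t' w] sub by (intro kobayashi_royden_le[OF c _ d V(1)]) auto
        also have "\<dots> \<le> ennreal (2 * V * (1 / \<epsilon> + 1 / \<delta>))"
        proof (rule ennreal_leI)
          have "1 / d \<le> 1 / \<epsilon> + 1 / \<delta>" using \<epsilon> \<delta> by (auto simp: d_def min_def)
          then show "2 * V / d \<le> 2 * V * (1 / \<epsilon> + 1 / \<delta>)"
            using V mult_left_mono[of "1 / d" "1 / \<epsilon> + 1 / \<delta>" "2 * V"] by simp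
        qed
        also have "\<dots> = ennreal (2 * V) * (ennreal (1 / \<epsilon>) + ennreal (1 / \<delta>))"
          using V \<epsilon> \<delta> by (simp add: ennreal_mult)
        also have "\<dots> \<le> ennreal (2 * V) * (ennreal (1 / \<epsilon>) + inv_dist_majorant N T (X t w))"
          using \<delta> by (intro mult_left_mono add_left_mono) auto
        finally show "kobayashi_royden A (B - S) (\<gamma> t) (velocity A \<gamma> t)
          \<le> ennreal (2 * V) * (ennreal (1 / \<epsilon>) + inv_dist_majorant N T (X t w))" .
      qed
    qed
  qed
  then show ?thesis using r by blast
qed

text \<open>Sweeps exist over short intervals, which stay in one chart, and can be joined; bisection gives one
over the whole interval.\<close>

lemma smooth_path_has_sweep:
  assumes \<rho>: "riemannian_metric A \<rho>" and B: "open B"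
    and P: "continuous_on UNIV P" "\<And>t. t \<in> {0..1} \<Longrightarrow> P t \<in> B"
      "\<And>c. c \<in> A \<Longrightarrow> smooth_on {t. P t \<in> fst c} (\<lambda>t. snd c (P t))"
  shows "\<exists>r>0. \<exists>C L K \<Gamma>. sweep B \<rho> P 0 1 r C L K \<Gamma>"
proof -
  \<comment> \<open>Bisection also meets degenerate intervals and intervals that leave \<open>{0..1}\<close>; both are exempted.\<close>
  let ?has = "\<lambda>a b. 0 \<le> a \<and> a < b \<and> b \<le> 1 \<longrightarrow> (\<exists>r>0. \<exists>C L K \<Gamma>. sweep B \<rho> P a b r C L K \<Gamma>)"
  have "?has 0 1"
  proof (induction rule: Bolzano[of 0 1 ?has, OF zero_le_one])
    case (1 a b c)
    show ?case
    proof (cases "a = b \<or> b = c")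
      case True
      then show ?thesis using 1 by auto
    next
      case False
      show ?thesis
      proof
        assume "0 \<le> a \<and> a < c \<and> c \<le> 1"
        then obtain r1 C1 L1 K1 \<Gamma>1 r2 C2 L2 K2 \<Gamma>2 where
          s: "r1 > 0" "sweep B \<rho> P a b r1 C1 L1 K1 \<Gamma>1" "r2 > 0" "sweep B \<rho> P b c r2 C2 L2 K2 \<Gamma>2"
          using 1 False by (metis less_eq_real_def order.trans)
        have "sweep B \<rho> P a b (min r1 r2) C1 L1 K1 \<Gamma>1" "sweep B \<rho> P b c (min r1 r2) C2 L2 K2 \<Gamma>2"
          by (rule sweep_shrink[OF s(2)] sweep_shrink[OF s(4)]; simp)+
        from sweep_join[OF this 1(3,4)] show "\<exists>r>0. \<exists>C L K \<Gamma>. sweep B \<rho> P a c r C L K \<Gamma>"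
          using s(1,3) min_less_iff_conj[of 0 r1 r2] by blast
      qed
    qed
  next
    case (2 x)
    define c where "c = chart_at (P x)"
    have c: "c \<in> A" "P x \<in> fst c" using chart_at[of "P x"] by (auto simp: c_def)
    have "open (P -` (fst c \<inter> B))" using P(1) B open_chart[OF c(1)] by (intro open_vimage open_Int)
    moreover have "x \<in> P -` (fst c \<inter> B)" using c P(2)[of x] 2 by auto
    ultimately obtain d where d: "d > 0" "ball x d \<subseteq> P -` (fst c \<inter> B)" by (meson openE)
    obtain D where D: "\<And>t. P t \<in> fst c \<Longrightarrow> ((\<lambda>t. snd c (P t)) has_derivative D t) (at t)"
      "\<And>v. continuous_on {t. P t \<in> fst c} (\<lambda>t. D t v)"
      using P(3)[OF c(1)] unfolding smooth_on_def by (metis Ck_on.simps mem_Collect_eq)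
    have "?has a b" if ab: "a \<le> x \<and> x \<le> b \<and> b - a < d" for a b
    proof
      assume ab': "0 \<le> a \<and> a < b \<and> b \<le> 1"
      have sub: "P t \<in> fst c \<inter> B" if "t \<in> {a..b}" for t
      proof -
        have "t \<in> ball x d" using that ab by (auto simp: dist_real_def)
        then show ?thesis using d by auto
      qed
      show "\<exists>r>0. \<exists>C L K \<Gamma>. sweep B \<rho> P a b r C L K \<Gamma>"
      proof (rule sweep_exists_in_chart[where a = a and b = b and p' = "\<lambda>t. D t 1", OF \<rho> B _ _ _ c(1) sub])
        fix t assume t: "t \<in> {a..b}"
        have "((\<lambda>t. snd c (P t)) has_derivative D t) (at t within {a..b})"
          using D(1)[of t] sub[OF t] by (auto intro: has_derivative_at_withinI)
        moreover have "D t = (\<lambda>h. h *\<^sub>R D t 1)"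
        proof
          fix h :: real
          have "D t (h *\<^sub>R 1) = h *\<^sub>R D t 1"
            using D(1)[of t] sub[OF t] by (intro linear_scale[OF has_derivative_linear]) auto
          then show "D t h = h *\<^sub>R D t 1" by simp
        qed
        ultimately show "((\<lambda>t. snd c (P t)) has_vector_derivative D t 1) (at t within {a..b})"
          unfolding has_vector_derivative_def by metis
      next
        show "continuous_on {a..b} (\<lambda>t. D t 1)"
          using D(2) by (rule continuous_on_subset) (use sub in auto)
      qed (use ab' in auto)
    qed
    then show ?case using d by blast
  qed
  then show ?thesis by simp
qed

text \<open>These paths serve as \<open>\<sigma>\<close>; the injectivity excludes the finitely many \<open>w\<close> that move \<open>x\<close> into \<open>S\<close>.\<close>

lemma nudge_paths:
  assumes \<rho>: "riemannian_metric A \<rho>" and B: "open B" "x \<in> B"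
  shows "\<exists>R>0. \<exists>L\<ge>0. \<exists>K. compact K \<and> K \<subseteq> B \<and> inj_on (nudge x) (cball 0 R) \<and>
    (\<forall>w\<in>cball 0 R. nudge x w \<in> K \<and> pw_C1_path A (\<lambda>s. nudge x (of_real s * w)) \<and>
       riemannian_length A \<rho> (\<lambda>s. nudge x (of_real s * w)) \<le> ennreal L)"
proof -
  define c where "c = chart_at x"
  have c: "c \<in> A" "x \<in> fst c" using chart_at[of x] by (auto simp: c_def)
  define z where "z = snd c x"
  have nudge: "nudge x w = inv_chart c (z + w)" for w by (simp add: nudge_def c_def z_def)
  have "open (snd c ` (fst c \<inter> B))" by (rule open_chart_subimage[OF c(1) B(1)])
  moreover have "z \<in> snd c ` (fst c \<inter> B)" using c B by (auto simp: z_def)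
  ultimately obtain R where R: "R > 0" "cball z R \<subseteq> snd c ` (fst c \<inter> B)" by (meson open_contains_cball)
  have in_cball: "z + of_real s * w \<in> cball z R" if "w \<in> cball 0 R" "s \<in> {0..1}" for s w
  proof -
    have "\<bar>s\<bar> * norm w \<le> 1 * R" using that by (intro mult_mono) auto
    then show ?thesis by (simp add: dist_norm norm_mult)
  qed
  have sub: "cball z R \<subseteq> snd c ` fst c" using R(2) by blast
  obtain L where L: "L \<ge> 0" "\<And>y v. y \<in> cball z R \<Longrightarrow> sqrt (\<rho> (inv_chart c y) (tvec_of_coord A (inv_chart c y) c v)
             (tvec_of_coord A (inv_chart c y) c v)) \<le> L * norm v"
    using riemannian_norm_le[OF \<rho> c(1) compact_cball sub] by blast
  define K where "K = inv_chart c ` cball z R"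
  have K: "compact K" "K \<subseteq> B"
  proof -
    show "compact K" unfolding K_def
      by (intro compact_continuous_image continuous_on_subset[OF continuous_on_inv_chart[OF c(1)] sub] compact_cball)
    show "K \<subseteq> B" unfolding K_def
    proof (rule image_subsetI)
      fix y assume "y \<in> cball z R"
      then obtain u where "u \<in> fst c" "u \<in> B" "y = snd c u" using R(2) by blast
      then show "inv_chart c y \<in> B" using inv_chart_chart[OF c(1), of u] by simp
    qed
  qed
  have chart_nudge: "snd c (nudge x w) = z + w" if "z + w \<in> cball z R" for w
    unfolding nudge by (rule chart_inv_chart[OF c(1) subsetD[OF sub that]])
  have inj: "inj_on (nudge x) (cball 0 R)"
  proof (rule inj_onI)
    fix w w' assume w: "w \<in> cball 0 R" "w' \<in> cball 0 R" and eq: "nudge x w = nudge x w'"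
    have "z + w \<in> cball z R" "z + w' \<in> cball z R" using w by (simp_all add: dist_norm)
    then have "snd c (nudge x w) = z + w" "snd c (nudge x w') = z + w'" by (blast intro: chart_nudge)+
    then show "w = w'" using eq by (metis add_left_cancel)
  qed
  have "nudge x w \<in> K \<and> pw_C1_path A (\<lambda>s. nudge x (of_real s * w)) \<and>
       riemannian_length A \<rho> (\<lambda>s. nudge x (of_real s * w)) \<le> ennreal (L * R)" if w: "w \<in> cball 0 R" for w
  proof (intro conjI)
    let ?\<sigma> = "\<lambda>s. nudge x (of_real s * w)"
    have d: "((\<lambda>s. z + of_real s * w) has_vector_derivative w) (at s within S)" for s S
    proof -
      have "((\<lambda>s. z + s *\<^sub>R w) has_vector_derivative 0 + 1 *\<^sub>R w) (at s within S)"
        by (rule has_vector_derivative_eq_rhs, (rule derivative_intros)+) simp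
      then show ?thesis by (simp add: scaleR_conv_of_real)
    qed
    show "nudge x w \<in> K" using in_cball[OF w, of 1] by (auto simp: nudge K_def)
    have "C1_curve_on A {0..1} ?\<sigma>"
      using subsetD[OF sub in_cball[OF w]] d
      by (intro C1_curve_on_inv_chart[OF c(1), of _ "\<lambda>s. z + of_real s * w" "\<lambda>_. w"]) (simp_all add: nudge)
    then show "pw_C1_path A ?\<sigma>" unfolding pw_C1_path_def
      by (intro exI[of _ 1] exI[of _ "\<lambda>i. of_nat i"]) simp
    have "riemannian_length A \<rho> ?\<sigma> \<le> (\<integral>\<^sup>+s\<in>{0..1::real}. ennreal (L * R) \<partial>lborel)"
      unfolding riemannian_length_def
    proof (rule set_nn_integral_mono_open_interval)
      fix s :: real assume s: "s \<in> {0<..<1}"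
      have "velocity A ?\<sigma> s = tvec_of_coord A (?\<sigma> s) c w"
      proof (rule velocity_eq_tvec_of_coord[OF c(1) _ _ s])
        show "continuous_on {0<..<1} (\<lambda>s. z + complex_of_real s * w)" by (intro continuous_intros)
        fix t :: real assume "t \<in> {0<..<1}"
        then have "z + of_real t * w \<in> snd c ` fst c" using subsetD[OF sub in_cball[OF w, of t]] by simp
        then show "?\<sigma> t \<in> fst c \<and> snd c (?\<sigma> t) = z + complex_of_real t * w"
          unfolding nudge by (intro conjI inv_chart_in chart_inv_chart[OF c(1)])
      qed (use d in auto)
      then have "sqrt (\<rho> (?\<sigma> s) (velocity A ?\<sigma> s) (velocity A ?\<sigma> s)) \<le> L * norm w"
        using L(2)[OF in_cball[OF w, of s]] s by (simp add: nudge)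
      also have "\<dots> \<le> L * R" using L(1) w by (intro mult_left_mono) auto
      finally show "ennreal (sqrt (\<rho> (?\<sigma> s) (velocity A ?\<sigma> s) (velocity A ?\<sigma> s))) \<le> ennreal (L * R)"
        by (rule ennreal_leI)
    qed
    also have "\<dots> = ennreal (L * R)" by (subst nn_integral_cmult_indicator) auto
    finally show "riemannian_length A \<rho> ?\<sigma> \<le> ennreal (L * R)" .
  qed
  moreover have "L * R \<ge> 0" using L(1) R(1) by simp
  ultimately show ?thesis using R(1) K inj by blast
qed

lemma smooth_loop_lift:
  assumes "smooth_loop A p"
  shows "\<exists>P. (\<forall>t\<in>{0..1}. P t = p t) \<and> continuous_on UNIV P \<and>
    (\<forall>c\<in>A. smooth_on {t. P t \<in> fst c} (\<lambda>t. snd c (P t)))"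
proof -
  from assms obtain F where "\<forall>t\<in>{0..1}. p t = F (cis (2 * pi * t))"
    "continuous_on UNIV (\<lambda>t. F (cis (2 * pi * t)))"
    "\<forall>(U, \<phi>)\<in>A. smooth_on {t. F (cis (2 * pi * t)) \<in> U} (\<lambda>t. \<phi> (F (cis (2 * pi * t))))"
    unfolding smooth_loop_def by blast
  then show ?thesis by (intro exI[of _ "\<lambda>t. F (cis (2 * pi * t))"]) (auto simp: case_prod_unfold)
qed

end

section \<open>Short loops off a finite set\<close>

lemma sqrt_le_sqrt_log:
  assumes "s \<ge> 1"
  shows "sqrt (real s) \<le> sqrt ((real s + 1) * ln (real s + 2))"
proof -
  have "exp 1 \<le> real s + 2" using exp_le assms by linarith
  then have "1 \<le> ln (real s + 2)" using assms by (subst ln_ge_iff) auto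
  then have "real s * 1 \<le> (real s + 1) * ln (real s + 2)" by (intro mult_mono) auto
  then show ?thesis by simp
qed

theorem proposition2p5:
  fixes A :: "('a::t2_space) atlas"
    and \<rho> :: "'a \<Rightarrow> 'a tvec \<Rightarrow> 'a tvec \<Rightarrow> real"
    and \<Delta> :: "nat \<Rightarrow> 'a set"
    and B\<^sub>0 :: "'a set" and b\<^sub>0 :: 'a
    and \<alpha> :: "nat \<Rightarrow> (real \<Rightarrow> 'a) set"
    and t k :: nat
  assumes "compact_riemann_surface A"
    and "riemannian_metric A \<rho>"
    and "t \<ge> 1"
    and "\<forall>i\<in>{1..t}. closed_disk A (\<Delta> i)"
    and "disjoint_family_on \<Delta> {1..t}"
    and "B\<^sub>0 = UNIV - (\<Union>i\<in>{1..t}. \<Delta> i)"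
    and "b\<^sub>0 \<in> B\<^sub>0"
    and "simple_basis A B\<^sub>0 b\<^sub>0 k \<alpha>"
  shows "\<exists>C \<delta>' L\<^sub>0 :: real. \<exists>K\<^sub>0 :: 'a set.
    C > 0 \<and> \<delta>' > 0 \<and> L\<^sub>0 > 0 \<and> compact K\<^sub>0 \<and> K\<^sub>0 \<subseteq> B\<^sub>0 \<and>
    (\<forall>S s. finite S \<and> S \<subseteq> B\<^sub>0 \<and> card S = s \<and> s \<ge> 1 \<longrightarrow>
      (\<exists>q \<sigma> \<gamma>.
        q \<in> B\<^sub>0 - S \<and>
        pw_C1_path A \<sigma> \<and> pathstart \<sigma> = b\<^sub>0 \<and> pathfinish \<sigma> = q \<and> path_image \<sigma> \<subseteq> B\<^sub>0 \<and>
        riemannian_length A \<rho> \<sigma> \<le> ennreal \<delta>' \<and>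
        path_image \<sigma> \<subseteq> K\<^sub>0 \<and>
        (\<forall>j\<in>{1..k}.
          pw_C1_path A (\<gamma> j) \<and> pathstart (\<gamma> j) = q \<and> pathfinish (\<gamma> j) = q \<and>
          path_image (\<gamma> j) \<subseteq> B\<^sub>0 - S \<and>
          loop_class B\<^sub>0 (\<sigma> +++ \<gamma> j +++ reversepath \<sigma>) = \<alpha> j \<and>
          kobayashi_length A (B\<^sub>0 - S) (\<gamma> j) \<le> ennreal (C * sqrt ((real s + 1) * ln (real s + 2))) \<and>
          path_image (\<gamma> j) \<subseteq> K\<^sub>0 \<and>
          riemannian_length A \<rho> (\<gamma> j) \<le> ennreal L\<^sub>0)))"
proof -
  interpret riemann_surface A by unfold_locales (rule assms(1))
  note \<rho> = assms(2) and b0 = assms(7)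
  have B: "open B\<^sub>0"
    using assms(4) unfolding assms(6) closed_disk_def by (intro open_Diff open_UNIV closed_UN) auto
  have "\<exists>P r C L K \<Gamma>. P 0 = b\<^sub>0 \<and> P 1 = b\<^sub>0 \<and> \<alpha> j = loop_class B\<^sub>0 P \<and> r > 0 \<and> sweep B\<^sub>0 \<rho> P 0 1 r C L K \<Gamma>"
    if j: "j \<in> {1..k}" for j
  proof -
    obtain p where p: "p \<in> loops_at B\<^sub>0 b\<^sub>0" "smooth_loop A p" "\<alpha> j = loop_class B\<^sub>0 p"
      using assms(8) j unfolding simple_basis_def by blast
    obtain P where P: "\<forall>t\<in>{0..1}. P t = p t" "continuous_on UNIV P"
      "\<forall>c\<in>A. smooth_on {t. P t \<in> fst c} (\<lambda>t. snd c (P t))"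
      using smooth_loop_lift[OF p(2)] by blast
    have p_in: "path p" "path_image p \<subseteq> B\<^sub>0" "p 0 = b\<^sub>0" "p 1 = b\<^sub>0"
      using p(1) by (auto simp: loops_at_def pathstart_def pathfinish_def)
    have PB: "P t \<in> B\<^sub>0" if "t \<in> {0..1}" for t
      using P(1) p_in(2) that by (auto simp: path_image_def)
    have "homotopic_paths B\<^sub>0 p P" using p_in P(1) by (intro homotopic_paths_eq) auto
    then have "\<alpha> j = loop_class B\<^sub>0 P" using p(3) loop_class_eq by metis
    moreover have "P 0 = b\<^sub>0" "P 1 = b\<^sub>0" using P(1) p_in by auto
    moreover obtain r C L K \<Gamma> where "r > 0" "sweep B\<^sub>0 \<rho> P 0 1 r C L K \<Gamma>"
      using smooth_path_has_sweep[OF \<rho> B P(2) PB] P(3) by blast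
    ultimately show ?thesis by blast
  qed
  then obtain P r C L K \<Gamma> where P: "\<And>j. j \<in> {1..k} \<Longrightarrow> P j 0 = b\<^sub>0" "\<And>j. j \<in> {1..k} \<Longrightarrow> P j 1 = b\<^sub>0"
      "\<And>j. j \<in> {1..k} \<Longrightarrow> \<alpha> j = loop_class B\<^sub>0 (P j)"
    and r: "\<And>j. j \<in> {1..k} \<Longrightarrow> r j > 0"
    and sweeps: "\<And>j. j \<in> {1..k} \<Longrightarrow> sweep B\<^sub>0 \<rho> (P j) 0 1 (r j) (C j) (L j) (K j) (\<Gamma> j)"
    by metis
  obtain R L\<sigma> K\<sigma> where R: "R > 0" "L\<sigma> \<ge> 0" "compact K\<sigma>" "K\<sigma> \<subseteq> B\<^sub>0" "inj_on (nudge b\<^sub>0) (cball 0 R)"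
    and \<sigma>: "\<And>w. w \<in> cball 0 R \<Longrightarrow> nudge b\<^sub>0 w \<in> K\<sigma> \<and> pw_C1_path A (\<lambda>s. nudge b\<^sub>0 (of_real s * w)) \<and>
       riemannian_length A \<rho> (\<lambda>s. nudge b\<^sub>0 (of_real s * w)) \<le> ennreal L\<sigma>"
    using nudge_paths[OF \<rho> B b0] by blast
  define r0 where "r0 = Min (insert R (r ` {1..k}))"
  have r0: "r0 > 0" "r0 \<le> R" "\<And>j. j \<in> {1..k} \<Longrightarrow> r0 \<le> r j" 
  proof -
    show "r0 > 0" using r R(1) by (subst r0_def, subst Min_gr_iff) auto
    show "r0 \<le> R" "\<And>j. j \<in> {1..k} \<Longrightarrow> r0 \<le> r j" unfolding r0_def by (rule Min_le; simp)+
  qed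
  have sw: "sweep B\<^sub>0 \<rho> (P j) 0 1 r0 (C j) (L j) (K j) (\<Gamma> j)" if "j \<in> {1..k}" for j
    using sweep_shrink[OF sweeps r0(3)] that by blast
  have CL: "C j \<ge> 0" "L j \<ge> 0" if "j \<in> {1..k}" for j using sweep_nonneg[OF sw[OF that]] by auto
  \<comment> \<open>The added 1 puts \<open>D * sqrt s\<close> strictly above the average of the total cost, even for \<open>k = 0\<close>.\<close>
  define D where "D = ((\<Sum>j\<in>{1..k}. C j) + 1) / (pi * r0\<^sup>2)"
  define L\<^sub>0 where "L\<^sub>0 = (\<Sum>j\<in>{1..k}. L j) + 1"
  define K\<^sub>0 where "K\<^sub>0 = K\<sigma> \<union> (\<Union>j\<in>{1..k}. K j)"
  have sumC: "(\<Sum>j\<in>{1..k}. C j) \<ge> 0" by (intro sum_nonneg CL)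
  have D: "D > 0" using r0 sumC unfolding D_def by (intro divide_pos_pos) auto
  have L0: "L\<^sub>0 > 0" "\<And>j. j \<in> {1..k} \<Longrightarrow> L j \<le> L\<^sub>0"
  proof -
    have "(\<Sum>j\<in>{1..k}. L j) \<ge> 0" by (intro sum_nonneg CL)
    then show "L\<^sub>0 > 0" by (simp add: L\<^sub>0_def)
    show "L j \<le> L\<^sub>0" if "j \<in> {1..k}" for j
      using member_le_sum[OF that, of L] CL by (simp add: L\<^sub>0_def)
  qed
  have K0: "compact K\<^sub>0" "K\<^sub>0 \<subseteq> B\<^sub>0"
    unfolding K\<^sub>0_def
    by (intro compact_Un compact_UN R(3) sweep_compact(1)[OF sw]; simp)
       (intro Un_least UN_least R(4) sweep_compact(2)[OF sw])
  have main: "\<exists>q \<sigma> \<gamma>.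
        q \<in> B\<^sub>0 - S \<and>
        pw_C1_path A \<sigma> \<and> pathstart \<sigma> = b\<^sub>0 \<and> pathfinish \<sigma> = q \<and> path_image \<sigma> \<subseteq> B\<^sub>0 \<and>
        riemannian_length A \<rho> \<sigma> \<le> ennreal (L\<sigma> + 1) \<and>
        path_image \<sigma> \<subseteq> K\<^sub>0 \<and>
        (\<forall>j\<in>{1..k}.
          pw_C1_path A (\<gamma> j) \<and> pathstart (\<gamma> j) = q \<and> pathfinish (\<gamma> j) = q \<and>
          path_image (\<gamma> j) \<subseteq> B\<^sub>0 - S \<and>
          loop_class B\<^sub>0 (\<sigma> +++ \<gamma> j +++ reversepath \<sigma>) = \<alpha> j \<and>
          kobayashi_length A (B\<^sub>0 - S) (\<gamma> j) \<le> ennreal (D * sqrt ((real s + 1) * ln (real s + 2))) \<and>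
          path_image (\<gamma> j) \<subseteq> K\<^sub>0 \<and>
          riemannian_length A \<rho> (\<gamma> j) \<le> ennreal L\<^sub>0)"
    if S: "finite S" "S \<subseteq> B\<^sub>0" "card S = s" "s \<ge> 1" for S s
  proof -
    have "S \<noteq> {}" using S by auto
    define Q where "Q j M \<longleftrightarrow> M \<in> borel_measurable borel \<and>
        (\<integral>\<^sup>+w\<in>cball 0 r0. M w \<partial>lborel) \<le> ennreal (C j * sqrt s) \<and>
        (\<forall>w\<in>cball 0 r0. M w < \<infinity> \<longrightarrow>
           (\<forall>t\<in>{0..1}. \<Gamma> j w t \<notin> S) \<and> kobayashi_length A (B\<^sub>0 - S) (\<Gamma> j w) \<le> M w)" for j M
    have "\<exists>M. Q j M" if "j \<in> {1..k}" for j
      using sweep_cost[OF sw[OF that] S(1) \<open>S \<noteq> {}\<close>] unfolding Q_def kobayashi_length_def S(3) by blast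
    then obtain M where "\<forall>j\<in>{1..k}. Q j (M j)" using bchoice[of "{1..k}" Q] by blast
    then have M: "\<And>j. j \<in> {1..k} \<Longrightarrow> M j \<in> borel_measurable borel"
        "\<And>j. j \<in> {1..k} \<Longrightarrow> (\<integral>\<^sup>+w\<in>cball 0 r0. M j w \<partial>lborel) \<le> ennreal (C j * sqrt s)"
        "\<And>j w. j \<in> {1..k} \<Longrightarrow> w \<in> cball 0 r0 \<Longrightarrow> M j w < \<infinity> \<Longrightarrow>
           (\<forall>t\<in>{0..1}. \<Gamma> j w t \<notin> S) \<and> kobayashi_length A (B\<^sub>0 - S) (\<Gamma> j w) \<le> M j w"
      unfolding Q_def by blast+
    have W [measurable]: "cball 0 r0 \<in> sets (borel :: complex measure)" by simp
    have "(\<integral>\<^sup>+w\<in>cball 0 r0. (\<Sum>j\<in>{1..k}. M j w) \<partial>lborel)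
        = (\<Sum>j\<in>{1..k}. \<integral>\<^sup>+w\<in>cball 0 r0. M j w \<partial>lborel)"
      unfolding sum_distrib_right using M(1) by (intro nn_integral_sum) auto
    also have "\<dots> \<le> (\<Sum>j\<in>{1..k}. ennreal (C j * sqrt s))" by (intro sum_mono M(2))
    also have "\<dots> = ennreal ((\<Sum>j\<in>{1..k}. C j) * sqrt s)"
      using CL by (subst sum_ennreal) (auto simp: sum_distrib_right)
    finally have total: "(\<integral>\<^sup>+w\<in>cball 0 r0. (\<Sum>j\<in>{1..k}. M j w) \<partial>lborel) \<le> ennreal ((\<Sum>j\<in>{1..k}. C j) * sqrt s)" .
    \<comment> \<open>Costs of loops say nothing about \<open>q\<close> when \<open>k = 0\<close>, so \<open>q \<notin> S\<close> is secured separately.\<close>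
    define E where "E = {w \<in> cball 0 r0. nudge b\<^sub>0 w \<in> S}"
    have "inj_on (nudge b\<^sub>0) E" by (rule inj_on_subset[OF R(5)]) (use r0(2) in \<open>auto simp: E_def\<close>)
    then have E: "finite E" by (rule inj_on_finite[OF _ _ S(1)]) (auto simp: E_def)
    have area: "emeasure lborel (cball 0 r0 :: complex set) = ennreal (pi * r0\<^sup>2)"
      using r0(1) by (subst emeasure_cball) (auto simp: unit_ball_vol_2)
    have "\<exists>w\<in>cball 0 r0 - E. (\<Sum>j\<in>{1..k}. M j w) \<le> ennreal (D * sqrt s)"
    proof (rule exists_below_average[OF W area E total])
      show "(\<Sum>j\<in>{1..k}. C j) * sqrt s < D * sqrt s * (pi * r0\<^sup>2)"
        using r0(1) S(4) by (simp add: D_def field_simps)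
    qed (use D sumC in auto)
    then obtain w where w: "w \<in> cball 0 r0" "w \<notin> E" and Mw: "(\<Sum>j\<in>{1..k}. M j w) \<le> ennreal (D * sqrt s)"
      by blast
    have M_le: "M j w \<le> ennreal (D * sqrt s)" if "j \<in> {1..k}" for j
      using order_trans[OF member_le_sum[OF that, of "\<lambda>j. M j w"] Mw] by auto
    then have M_fin: "M j w < \<infinity>" if "j \<in> {1..k}" for j
      using that by (metis ennreal_less_top infinity_ennreal_def le_less_trans)
    have sw_in: "of_real u * w \<in> cball 0 r0" if "u \<in> {0..1}" for u
    proof -
      have "\<bar>u\<bar> * norm w \<le> 1 * r0" using that w by (intro mult_mono) auto
      then show ?thesis by (simp add: norm_mult)
    qed
    then have sw_inR: "of_real u * w \<in> cball 0 R" if "u \<in> {0..1}" for u using that r0(2) by fastforce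
    define \<sigma>' where "\<sigma>' u = nudge b\<^sub>0 (of_real u * w)" for u
    define q where "q = nudge b\<^sub>0 w"
    have ends: "\<Gamma> j v 0 = nudge b\<^sub>0 v" "\<Gamma> j v 1 = nudge b\<^sub>0 v" if "j \<in> {1..k}" "v \<in> cball 0 r0" for j v
      using sweep_ends[OF sw[OF that(1)] that(2)] P[OF that(1)] by auto
    have loop: "pw_C1_path A (\<Gamma> j w) \<and> pathstart (\<Gamma> j w) = q \<and> pathfinish (\<Gamma> j w) = q \<and>
          path_image (\<Gamma> j w) \<subseteq> B\<^sub>0 - S \<and>
          loop_class B\<^sub>0 (\<sigma>' +++ \<Gamma> j w +++ reversepath \<sigma>') = \<alpha> j \<and>
          kobayashi_length A (B\<^sub>0 - S) (\<Gamma> j w) \<le> ennreal (D * sqrt ((real s + 1) * ln (real s + 2))) \<and>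
          path_image (\<Gamma> j w) \<subseteq> K\<^sub>0 \<and>
          riemannian_length A \<rho> (\<Gamma> j w) \<le> ennreal L\<^sub>0" if j: "j \<in> {1..k}" for j
    proof (intro conjI)
      note swj = sw[OF j]
      show "pw_C1_path A (\<Gamma> j w)"
        using sweep_pw_C1[OF swj w(1)] by (simp add: pw_C1_path_def pw_C1_on_def)
      show "pathstart (\<Gamma> j w) = q" "pathfinish (\<Gamma> j w) = q"
        using ends[OF j w(1)] by (auto simp: pathstart_def pathfinish_def q_def)
      show inK: "path_image (\<Gamma> j w) \<subseteq> K\<^sub>0"
        using sweep_in[OF swj w(1)] j by (auto simp: path_image_def K\<^sub>0_def)
      show "path_image (\<Gamma> j w) \<subseteq> B\<^sub>0 - S"
        using inK K0(2) M(3)[OF j w(1) M_fin[OF j]] by (auto simp: path_image_def)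
      have "kobayashi_length A (B\<^sub>0 - S) (\<Gamma> j w) \<le> M j w" using M(3)[OF j w(1) M_fin[OF j]] by blast
      also have "\<dots> \<le> ennreal (D * sqrt s)" by (rule M_le[OF j])
      also have "\<dots> \<le> ennreal (D * sqrt ((real s + 1) * ln (real s + 2)))"
        using D sqrt_le_sqrt_log[OF S(4)] by (intro ennreal_leI mult_left_mono) auto
      finally show "kobayashi_length A (B\<^sub>0 - S) (\<Gamma> j w) \<le> ennreal (D * sqrt ((real s + 1) * ln (real s + 2)))" .
      have "riemannian_length A \<rho> (\<Gamma> j w) \<le> ennreal (L j)"
        unfolding riemannian_length_def by (rule sweep_length[OF swj w(1)]) simp
      also have "\<dots> \<le> ennreal L\<^sub>0" by (rule ennreal_leI[OF L0(2)[OF j]])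
      finally show "riemannian_length A \<rho> (\<Gamma> j w) \<le> ennreal L\<^sub>0" .
      \<comment> \<open>The loop moves freely as \<open>w\<close> is scaled down to \<open>0\<close>, and its base point runs along \<open>\<sigma>'\<close>.\<close>
      define H where "H = (\<lambda>(v, t). \<Gamma> j v t) \<circ> (\<lambda>p. (of_real (fst p) * w, snd p))"
      have H: "H (u, t) = \<Gamma> j (of_real u * w) t" for u t by (simp add: H_def)
      have im: "(\<lambda>p. (of_real (fst p) * w, snd p)) ` ({0..1} \<times> {0..1}) \<subseteq> cball 0 r0 \<times> {0..1::real}"
        using sw_in by auto
      have "homotopic_paths B\<^sub>0 (P j) (\<sigma>' +++ \<Gamma> j w +++ reversepath \<sigma>')"
      proof (rule homotopic_paths_conjugate_square[of H])
        show "continuous_on ({0..1} \<times> {0..1}) H"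
          unfolding H_def
          by (intro continuous_on_compose continuous_on_subset[OF sweep_continuous[OF swj] im] continuous_intros)
        show "H ` ({0..1} \<times> {0..1}) \<subseteq> B\<^sub>0"
          using sweep_in[OF swj sw_in] sweep_compact(2)[OF swj] by (auto simp: H)
        show "H (0, t) = P j t" if "t \<in> {0..1}" for t using sweep_zero[OF swj that] by (simp add: H)
        show "H (1, t) = \<Gamma> j w t" for t by (simp add: H)
        show "H (u, 0) = \<sigma>' u" "H (u, 1) = \<sigma>' u" if "u \<in> {0..1}" for u
          using ends[OF j sw_in[OF that]] by (auto simp: H \<sigma>'_def)
      qed
      then show "loop_class B\<^sub>0 (\<sigma>' +++ \<Gamma> j w +++ reversepath \<sigma>') = \<alpha> j"
        using P(3)[OF j] loop_class_eq by metis
    qed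
    have \<sigma>K: "path_image \<sigma>' \<subseteq> K\<^sub>0"
      using \<sigma>[OF sw_inR] by (auto simp: path_image_def \<sigma>'_def K\<^sub>0_def)
    have wR: "w \<in> cball 0 R" using sw_inR[of 1] by simp
    have start: "pathstart \<sigma>' = b\<^sub>0" "pathfinish \<sigma>' = q"
      using nudge_zero by (auto simp: pathstart_def pathfinish_def \<sigma>'_def q_def)
    have \<sigma>': "pw_C1_path A \<sigma>'" "riemannian_length A \<rho> \<sigma>' \<le> ennreal (L\<sigma> + 1)"
      using \<sigma>[OF wR] order_trans[OF _ ennreal_leI[of L\<sigma> "L\<sigma> + 1"]] by (auto simp: \<sigma>'_def[abs_def])
    have "q \<in> B\<^sub>0 - S" using w \<sigma>[OF wR] R(4) by (auto simp: E_def q_def)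
    then show ?thesis
      using loop \<sigma>K \<sigma>' start K0(2)
      by (intro exI[of _ q] exI[of _ \<sigma>'] exI[of _ "\<lambda>j. \<Gamma> j w"]) blast
  qed
  show ?thesis
    using D L0(1) R(2) K0 main
    by (intro exI[of _ D] exI[of _ "L\<sigma> + 1"] exI[of _ L\<^sub>0] exI[of _ K\<^sub>0]) auto
qed

end
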